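(* For a characteristic Killing tensor (CKT) $\boldsymbol{K}$ on $\mathbb{S}^3$, regarded as a Killing tensor on the ambient space $\mathbb{E}^4$, let $\mathrm{Sym}(\boldsymbol{K})$ be the set of all Killing vectors $\boldsymbol{V}$ of $\mathbb{E}^4$ for which there is $\alpha\in\mathbb{R}$ with $\mathcal{L}_{\boldsymbol{V}}(\boldsymbol{K}+\alpha\,\boldsymbol{\mathcal{C}})=0$, where $\boldsymbol{\mathcal{C}}$ is the Casimir tensor. Then the six canonical webs of $\mathbb{S}^3$ have the following symmetries, where in each case $\boldsymbol{K}$ is a CKT in the canonical form of the indicated web: (I) cylindrical web: $\mathrm{Sym}(\boldsymbol{K})$ is spanned by the two rotations $\boldsymbol{R}_{12},\boldsymbol{R}_{34}$; (II) spherical web: $\mathrm{Sym}(\boldsymbol{K})$ is spanned by one rotation $\boldsymbol{R}_{12}$ and one translation $\boldsymbol{X}_4$; (III) spheroelliptic web: $\mathrm{Sym}(\boldsymbol{K})$ is spanned by one translation $\boldsymbol{X}_4$; (IV) elliptic-cylindrical webs of type 1 and of type 2: $\mathrm{Sym}(\boldsymbol{K})$ is spanned by one rotation $\boldsymbol{R}_{12}$; (V) ellipsoidal web: $\mathrm{Sym}(\boldsymbol{K})=\{0\}$. Moreover, translational and rotational symmetries are inequivalent under the action of $\mathrm{SO}(4)$, so that the number of symmetry generators of each type is the same for all CKTs in an $\mathrm{SO}(4)$-orbit and determines the category (I)–(V) of the orbit.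
   Context: $x^1,\ldots,x^4$ are Cartesian coordinates on $\mathbb{E}^4$, $\boldsymbol{X}_i=\partial/\partial x^i$ (translations) and $\boldsymbol{R}_{ij}=x^j\boldsymbol{X}_i-x^i\boldsymbol{X}_j$ (rotations). The general Killing vector of $\mathbb{E}^4$ is $A^i\boldsymbol{X}_i+\sum_{i<j}B^{ij}\boldsymbol{R}_{ij}$ with constants $A^i,B^{ij}$. Here "translation" means a Killing vector with all $B^{ij}=0$, and "rotation" one with all $A^i=0$. $\odot$ is the symmetric tensor product and $\mathcal{L}$ the Lie derivative. Valence two Killing tensors on $\mathbb{S}^3=\{\boldsymbol{x}\cdot\boldsymbol{x}=1\}$ are identified with the tensors on $\mathbb{E}^4$ that are linear combinations (constant coefficients) of the $\boldsymbol{R}_{ij}\odot\boldsymbol{R}_{k\ell}$. $\mathrm{SO}(4)$ acts on them by push-forward. The Casimir tensor is, up to a nonzero constant, $\boldsymbol{\mathcal{C}}=\sum_{i<j}\boldsymbol{R}_{ij}\odot\boldsymbol{R}_{ij}$, the image of the contravariant metric of $\mathbb{S}^3$. A characteristic Killing tensor (CKT) on $\mathbb{S}^3$ is a valence two Killing tensor whose eigenvalues (relative to the metric of $\mathbb{S}^3$) are real and pointwise simple (away from singular points) and whose eigenvector fields are normal, i.e. orthogonally integrable. It generates an orthogonally separable web, namely the three foliations by surfaces orthogonal to its eigenvectors. By Olevsky's known classification, every CKT on $\mathbb{S}^3$ is, under the action of $\mathrm{SO}(4)$ and up to adding a multiple of $\boldsymbol{\mathcal{C}}$, one of the following canonical forms,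 where the $c_i$ are real constants and $\boldsymbol{R}_{ij}^2:=\boldsymbol{R}_{ij}\odot\boldsymbol{R}_{ij}$: Spherical: $c_1\boldsymbol{R}_{12}^2+c_2(\boldsymbol{R}_{13}^2+\boldsymbol{R}_{23}^2)$. Cylindrical: $c_1\boldsymbol{R}_{12}^2+c_2(\boldsymbol{R}_{13}^2+\boldsymbol{R}_{14}^2+\boldsymbol{R}_{23}^2+\boldsymbol{R}_{24}^2)+c_3\boldsymbol{R}_{34}^2$. Elliptic-cylindrical of type 1 and of type 2: $c_1\boldsymbol{R}_{12}^2+c_2(\boldsymbol{R}_{13}^2+\boldsymbol{R}_{23}^2)+c_3(\boldsymbol{R}_{14}^2+\boldsymbol{R}_{24}^2)+c_4\boldsymbol{R}_{34}^2$, with essential parameter $k^2=\frac{c_4-c_2}{c_4-c_3}$ for type 1 and $k^2=\frac{c_4-c_3}{c_2-c_3}$ for type 2. Spheroelliptic: $c_1\boldsymbol{R}_{12}^2+c_2\boldsymbol{R}_{13}^2+c_3\boldsymbol{R}_{23}^2$. Ellipsoidal: $c_1\boldsymbol{R}_{12}^2+c_2\boldsymbol{R}_{13}^2+c_3\boldsymbol{R}_{14}^2+c_4\boldsymbol{R}_{23}^2+c_5\boldsymbol{R}_{24}^2+c_6\boldsymbol{R}_{34}^2$ with $(c_3+c_4)(c_1c_6-c_2c_5)+(c_2+c_5)(c_3c_4-c_1c_6)+(c_1+c_6)(c_2c_5-c_3c_4)=0$. Degenerate parameter values are excluded: a CKT "in the canonical form of" the spheroelliptic web is not $\mathrm{SO}(4)$-equivalent,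 modulo multiples of $\boldsymbol{\mathcal{C}}$, to a spherical one; for an elliptic-cylindrical web it is not so equivalent to a spherical or cylindrical one; and for the ellipsoidal web it is not so equivalent to any of the other five. *)

theory Defs
  imports "HOL-Analysis.Analysis" "HOL-Library.Function_Algebras"
begin

section \<open>Tensor fields as a real vector space\<close>

text \<open>Pointwise scalar multiplication. It makes fields a real vector space, so that
  \<^const>\<open>span\<close> and \<^const>\<open>dim\<close> apply to them with constant coefficients.\<close>

instantiation "fun" :: (type, scaleR) scaleR
begin

definition scaleR_fun_def: "scaleR r f = (\<lambda>x. scaleR r (f x))"

instance ..

end

instance "fun" :: (type, real_vector) real_vector
  by standard (auto simp: scaleR_fun_def plus_fun_def scaleR_add_right scaleR_add_left)

text \<open>Vector fields, and contravariant tensor fields of valence two, on Euclidean 4-space, given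
  by their Cartesian components. The type \<open>4\<close> indexes the coordinates by \<open>1, 2, 3, 4\<close>,
  where \<open>4 = 0\<close>.\<close>

type_synonym vfield = "real^4 \<Rightarrow> real^4"
type_synonym tfield = "real^4 \<Rightarrow> real^4^4"

definition sym_prod :: "vfield \<Rightarrow> vfield \<Rightarrow> tfield"  (infixl "\<odot>" 75) where
  "V \<odot> W = (\<lambda>x. \<chi> i j. (V x $ i * W x $ j + V x $ j * W x $ i) / 2)"

text \<open>In components, \<open>V\<^sup>k \<partial>\<^sub>k K\<^sup>i\<^sup>j - K\<^sup>k\<^sup>j \<partial>\<^sub>k V\<^sup>i - K\<^sup>i\<^sup>k \<partial>\<^sub>k V\<^sup>j\<close>.\<close>

definition lie_deriv :: "vfield \<Rightarrow> tfield \<Rightarrow> tfield" where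
  "lie_deriv V K = (\<lambda>x. frechet_derivative K (at x) (V x)
     - jacobian V (at x) ** K x - K x ** transpose (jacobian V (at x)))"


section \<open>Killing vectors and Killing tensors\<close>

definition X :: "4 \<Rightarrow> vfield" where
  "X i = (\<lambda>x. axis i 1)"

definition R :: "4 \<Rightarrow> 4 \<Rightarrow> vfield" where
  "R i j = (\<lambda>x. (x $ j) *\<^sub>R X i x - (x $ i) *\<^sub>R X j x)"

definition translation_vectors :: "vfield set" where
  "translation_vectors = span {X i |i. True}"

definition rotation_vectors :: "vfield set" where
  "rotation_vectors = span {R i j |i j. True}"

definition killing_vectors :: "vfield set" where
  "killing_vectors = span ({X i |i. True} \<union> {R i j |i j. True})"

definition killing_tensors_S3 :: "tfield set" where
  "killing_tensors_S3 = span {R i j \<odot> R k l |i j k l. True}"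

definition Rsq :: "4 \<Rightarrow> 4 \<Rightarrow> tfield" where
  "Rsq i j = R i j \<odot> R i j"

definition casimir :: tfield where
  "casimir = Rsq 1 2 + Rsq 1 3 + Rsq 1 4 + Rsq 2 3 + Rsq 2 4 + Rsq 3 4"

definition Sym :: "tfield \<Rightarrow> vfield set" where
  "Sym K = {V \<in> killing_vectors. \<exists>\<alpha>::real. lie_deriv V (K + \<alpha> *\<^sub>R casimir) = 0}"


section \<open>Characteristic Killing tensors\<close>

text \<open>Elements of \<^const>\<open>killing_tensors_S3\<close> are tangent to the unit sphere. Lowering
  an index with the metric of the sphere, which is induced by the ambient inner product, turns
  the value at \<open>x\<close> into the endomorphism \<open>v \<mapsto> K x *v v\<close> of the tangent space at \<open>x\<close>.\<close>

definition eigenpair :: "tfield \<Rightarrow> real^4 \<Rightarrow> real \<Rightarrow> real^4 \<Rightarrow> bool" where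
  "eigenpair K x l v \<longleftrightarrow> v \<noteq> 0 \<and> x \<bullet> v = 0 \<and> K x *v v = l *\<^sub>R v"

text \<open>The tangent spaces have dimension three, so three different real eigenvalues means that
  all eigenvalues are real and simple. The singular points are those where this fails.\<close>

definition simple_at :: "tfield \<Rightarrow> real^4 \<Rightarrow> bool" where
  "simple_at K x \<longleftrightarrow> card {l. \<exists>v. eigenpair K x l v} = 3"

definition tangential :: "real^4 \<Rightarrow> real^4 \<Rightarrow> real^4" where
  "tangential x v = v - (v \<bullet> x) *\<^sub>R x"

text \<open>Orthogonal integrability near a nonsingular point \<open>p\<close>, for the eigenvector field through the
  eigenvector \<open>v\<close> at \<open>p\<close>: there is a continuously differentiable local function \<open>u\<close> on the
  sphere (given as the restriction of an ambient function with gradient \<open>G\<close>), whose gradient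
  along the sphere is everywhere a nonzero eigenvector, and a multiple of \<open>v\<close> at \<open>p\<close>. The level
  sets of \<open>u\<close> then form the foliation by surfaces orthogonal to the eigenvectors.\<close>

definition normal_at :: "tfield \<Rightarrow> real^4 \<Rightarrow> real^4 \<Rightarrow> bool" where
  "normal_at K p v \<longleftrightarrow>
     (\<exists>U (u :: real^4 \<Rightarrow> real) (G :: real^4 \<Rightarrow> real^4).
        open U \<and> p \<in> U \<and> continuous_on U G \<and>
        (\<forall>x\<in>U. (u has_derivative (\<lambda>h. G x \<bullet> h)) (at x)) \<and>
        (\<forall>x \<in> U \<inter> sphere 0 1. \<exists>l. eigenpair K x l (tangential x (G x))) \<and>
        (\<exists>s. tangential p (G p) = s *\<^sub>R v))"

definition CKT :: "tfield \<Rightarrow> bool" where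
  "CKT K \<longleftrightarrow> K \<in> killing_tensors_S3 \<and>
     sphere 0 1 \<subseteq> closure {x \<in> sphere 0 1. simple_at K x} \<and>
     (\<forall>p \<in> sphere 0 1. simple_at K p \<longrightarrow>
        (\<forall>l v. eigenpair K p l v \<longrightarrow> normal_at K p v))"


section \<open>The action of SO(4)\<close>

text \<open>\<^const>\<open>rotation_matrix\<close> is membership in SO(4); the differential of \<open>x \<mapsto> g *v x\<close> is \<open>g\<close>.\<close>

definition push_vec :: "real^4^4 \<Rightarrow> vfield \<Rightarrow> vfield" where
  "push_vec g V = (\<lambda>x. g *v V (matrix_inv g *v x))"

definition push_ten :: "real^4^4 \<Rightarrow> tfield \<Rightarrow> tfield" where
  "push_ten g K = (\<lambda>x. g ** K (matrix_inv g *v x) ** transpose g)"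

definition equivalent :: "tfield \<Rightarrow> tfield \<Rightarrow> bool" where
  "equivalent K K' \<longleftrightarrow>
     (\<exists>g (\<beta>::real). rotation_matrix g \<and> K' = push_ten g K + \<beta> *\<^sub>R casimir)"


section \<open>Canonical forms\<close>

definition spherical_form :: "tfield \<Rightarrow> bool" where
  "spherical_form K \<longleftrightarrow> (\<exists>c1 c2 :: real.
     K = c1 *\<^sub>R Rsq 1 2 + c2 *\<^sub>R (Rsq 1 3 + Rsq 2 3))"

definition cylindrical_form :: "tfield \<Rightarrow> bool" where
  "cylindrical_form K \<longleftrightarrow> (\<exists>c1 c2 c3 :: real.
     K = c1 *\<^sub>R Rsq 1 2 + c2 *\<^sub>R (Rsq 1 3 + Rsq 1 4 + Rsq 2 3 + Rsq 2 4) + c3 *\<^sub>R Rsq 3 4)"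

text \<open>The two elliptic-cylindrical types share one formula and differ in the definition of the
  essential parameter \<open>k2\<close> (that is, \<open>k\<^sup>2\<close>), whose range is not restricted here beyond
  being defined.\<close>

definition elliptic_cylindrical :: "real \<Rightarrow> real \<Rightarrow> real \<Rightarrow> real \<Rightarrow> tfield" where
  "elliptic_cylindrical c1 c2 c3 c4 =
     c1 *\<^sub>R Rsq 1 2 + c2 *\<^sub>R (Rsq 1 3 + Rsq 2 3) + c3 *\<^sub>R (Rsq 1 4 + Rsq 2 4) + c4 *\<^sub>R Rsq 3 4"

definition elliptic_cylindrical1_form :: "real \<Rightarrow> tfield \<Rightarrow> bool" where
  "elliptic_cylindrical1_form k2 K \<longleftrightarrow> (\<exists>c1 c2 c3 c4.
     K = elliptic_cylindrical c1 c2 c3 c4 \<and> c4 \<noteq> c3 \<and> k2 = (c4 - c2) / (c4 - c3))"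

definition elliptic_cylindrical2_form :: "real \<Rightarrow> tfield \<Rightarrow> bool" where
  "elliptic_cylindrical2_form k2 K \<longleftrightarrow> (\<exists>c1 c2 c3 c4.
     K = elliptic_cylindrical c1 c2 c3 c4 \<and> c2 \<noteq> c3 \<and> k2 = (c4 - c3) / (c2 - c3))"

definition spheroelliptic_form :: "tfield \<Rightarrow> bool" where
  "spheroelliptic_form K \<longleftrightarrow> (\<exists>c1 c2 c3 :: real.
     K = c1 *\<^sub>R Rsq 1 2 + c2 *\<^sub>R Rsq 1 3 + c3 *\<^sub>R Rsq 2 3)"

definition ellipsoidal_form :: "tfield \<Rightarrow> bool" where
  "ellipsoidal_form K \<longleftrightarrow> (\<exists>c1 c2 c3 c4 c5 c6 :: real.
     K = c1 *\<^sub>R Rsq 1 2 + c2 *\<^sub>R Rsq 1 3 + c3 *\<^sub>R Rsq 1 4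
       + c4 *\<^sub>R Rsq 2 3 + c5 *\<^sub>R Rsq 2 4 + c6 *\<^sub>R Rsq 3 4 \<and>
     (c3 + c4) * (c1 * c6 - c2 * c5) + (c2 + c5) * (c3 * c4 - c1 * c6)
       + (c1 + c6) * (c2 * c5 - c3 * c4) = 0)"


section \<open>CKTs in canonical form, degenerate parameter values excluded\<close>

definition spherical_CKT :: "tfield \<Rightarrow> bool" where
  "spherical_CKT K \<longleftrightarrow> CKT K \<and> spherical_form K"

definition cylindrical_CKT :: "tfield \<Rightarrow> bool" where
  "cylindrical_CKT K \<longleftrightarrow> CKT K \<and> cylindrical_form K"

definition spheroelliptic_CKT :: "tfield \<Rightarrow> bool" where
  "spheroelliptic_CKT K \<longleftrightarrow> CKT K \<and> spheroelliptic_form K \<and>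
     \<not> (\<exists>K'. spherical_CKT K' \<and> equivalent K' K)"

definition elliptic_cylindrical1_CKT :: "real \<Rightarrow> tfield \<Rightarrow> bool" where
  "elliptic_cylindrical1_CKT k2 K \<longleftrightarrow> CKT K \<and> elliptic_cylindrical1_form k2 K \<and>
     \<not> (\<exists>K'. (spherical_CKT K' \<or> cylindrical_CKT K') \<and> equivalent K' K)"

definition elliptic_cylindrical2_CKT :: "real \<Rightarrow> tfield \<Rightarrow> bool" where
  "elliptic_cylindrical2_CKT k2 K \<longleftrightarrow> CKT K \<and> elliptic_cylindrical2_form k2 K \<and>
     \<not> (\<exists>K'. (spherical_CKT K' \<or> cylindrical_CKT K') \<and> equivalent K' K)"

definition ellipsoidal_CKT :: "tfield \<Rightarrow> bool" where
  "ellipsoidal_CKT K \<longleftrightarrow> CKT K \<and> ellipsoidal_form K \<and>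
     \<not> (\<exists>K'. (spherical_CKT K' \<or> cylindrical_CKT K' \<or> spheroelliptic_CKT K' \<or>
              (\<exists>k2. elliptic_cylindrical1_CKT k2 K' \<or> elliptic_cylindrical2_CKT k2 K')) \<and>
            equivalent K' K)"


section \<open>Categories of orbits and numbers of symmetry generators\<close>

datatype category =
  Cylindrical | Spherical | Spheroelliptic | Elliptic_Cylindrical | Ellipsoidal

fun canonical :: "category \<Rightarrow> tfield \<Rightarrow> bool" where
  "canonical Cylindrical K = cylindrical_CKT K"
| "canonical Spherical K = spherical_CKT K"
| "canonical Spheroelliptic K = spheroelliptic_CKT K"
| "canonical Elliptic_Cylindrical K =
     (\<exists>k2. elliptic_cylindrical1_CKT k2 K \<or> elliptic_cylindrical2_CKT k2 K)"
| "canonical Ellipsoidal K = ellipsoidal_CKT K"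

definition in_category :: "category \<Rightarrow> tfield \<Rightarrow> bool" where
  "in_category w K \<longleftrightarrow> (\<exists>K'. canonical w K' \<and> equivalent K' K)"

definition n_translations :: "tfield \<Rightarrow> nat" where
  "n_translations K = dim (Sym K \<inter> translation_vectors)"

definition n_rotations :: "tfield \<Rightarrow> nat" where
  "n_rotations K = dim (Sym K \<inter> rotation_vectors)"

definition olevsky_classification :: bool where
  "olevsky_classification \<longleftrightarrow> (\<forall>K. CKT K \<longrightarrow> (\<exists>K'. equivalent K' K \<and>
     (spherical_form K' \<or> cylindrical_form K' \<or> spheroelliptic_form K' \<or>
      (\<exists>k2. elliptic_cylindrical1_form k2 K' \<or> elliptic_cylindrical2_form k2 K') \<or>
      ellipsoidal_form K')))"

end

theory Submission
  imports Defs
begin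

text \<open>Every canonical form is a diagonal combination \<open>\<Sum>\<^sub>i\<^sub><\<^sub>j c\<^sub>i\<^sub>j R\<^sub>i\<^sub>j\<^sup>2\<close>, and adding a multiple of the
  Casimir tensor shifts all \<open>c\<^sub>i\<^sub>j\<close> by the same amount. A Killing vector is an affine field
  \<open>A + B x\<close> with \<open>B\<close> skew; since the tensor is quadratic in \<open>x\<close>, its Lie derivative splits into a
  linear part depending on \<open>A\<close> and a quadratic part depending on \<open>B\<close>. The component \<open>A\<^sub>k\<close> may be nonzero only
  if \<open>c\<^sub>i\<^sub>k\<close> does not depend on \<open>i\<close>, and \<open>B\<^sub>k\<^sub>m\<close> only if \<open>c\<^sub>i\<^sub>k = c\<^sub>i\<^sub>m\<close> for the two other indices \<open>i\<close>.
  Each unwanted symmetry therefore forces coincidences among the \<open>c\<^sub>i\<^sub>j\<close>. After a permutation of the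
  coordinates (made a rotation by a sign) and a shift, these yield either a tensor with at most two
  eigenvalues, which is not a CKT, or the canonical form of a more symmetric web.\<close>

section \<open>Killing vectors as affine fields\<close>

text \<open>Eliminating the unknown multiple \<alpha> of the Casimir tensor is what makes the
  symmetry conditions explicit. Rotations annihilate the Casimir tensor, so \<alpha> cannot
  influence the conditions on \<open>B\<close>, which accordingly contain only differences of
  coefficients. A translation does not annihilate it: \<open>X l\<close> needs a representative in
  which every \<open>c i l\<close> vanishes, and \<alpha> supplies one exactly when these
  coefficients agree. Since \<alpha> may vary with the field, linearity of \<open>Sym K\<close> is
  not evident beforehand; it comes out of the explicit computation. The category is recovered from
  two invariants, the dimensions of the translational and of the rotational part of
  \<open>Sym K\<close>. They are preserved because push-forward by a rotation is a linear bijection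
  of the vector fields that respects both types, and the five resulting pairs differ. Degenerate
  parameters are handled by a dichotomy: a CKT of canonical form either satisfies the exclusion
  clauses itself or lies in the orbit of a more symmetric canonical CKT.\<close>

lemmas fun_simps = plus_fun_def fun_diff_def fun_Compl_def zero_fun_def scaleR_fun_def

definition affine_field :: "real^4 \<Rightarrow> real^4^4 \<Rightarrow> vfield" where
  "affine_field A B = (\<lambda>x. A + B *v x)"

definition skew :: "real^4^4 \<Rightarrow> bool" where
  "skew B \<longleftrightarrow> transpose B = - B"

lemma skewD:
  assumes "skew B"
  shows "B $ j $ i = - B $ i $ j"
proof -
  have "transpose B $ i $ j = (- B) $ i $ j"
    using assms by (simp only: skew_def)
  then show ?thesis by (simp add: transpose_def)
qed

lemma skew_diag [simp]: "skew B \<Longrightarrow> B $ i $ i = 0"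
  using skewD[of B i i] by simp

text \<open>The value at the origin recovers \<open>A\<close>, and then the values at all points
  recover \<open>B\<close>. Identities between Killing vectors can therefore be checked on
  coefficients, and translations meet rotations only in 0.\<close>

lemma affine_field_eq_iff [simp]: "affine_field A B = affine_field A' B' \<longleftrightarrow> A = A' \<and> B = B'"
proof
  assume eq: "affine_field A B = affine_field A' B'"
  have A: "A = A'"
    using fun_cong[OF eq, of 0] by (simp add: affine_field_def)
  moreover have "B *v x = B' *v x" for x
    using fun_cong[OF eq, of x] A by (simp add: affine_field_def)
  ultimately show "A = A' \<and> B = B'"
    by (simp add: matrix_eq)
qed simp

lemma affine_field_add: "affine_field A B + affine_field A' B' = affine_field (A + A') (B + B')"
  by (simp add: affine_field_def fun_simps matrix_vector_mult_add_rdistrib algebra_simps)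

lemma affine_field_scaleR: "r *\<^sub>R affine_field A B = affine_field (r *\<^sub>R A) (r *\<^sub>R B)"
  by (simp add: affine_field_def fun_simps scaleR_add_right scaleR_matrix_vector_assoc)

lemma affine_field_0 [simp]: "affine_field 0 0 = 0"
  by (simp add: affine_field_def fun_simps)

lemma X_affine: "X i = affine_field (axis i 1) 0"
  by (simp add: X_def affine_field_def)

definition elementary_skew :: "4 \<Rightarrow> 4 \<Rightarrow> real^4^4" where
  "elementary_skew i j = (\<chi> k l. axis i 1 $ k * axis j 1 $ l - axis j 1 $ k * axis i 1 $ l)"

lemma R_affine: "R i j = affine_field 0 (elementary_skew i j)"
  by (auto simp: elementary_skew_def fun_eq_iff R_def X_def affine_field_def vec_eq_iff matrix_vector_mult_def
      left_diff_distrib sum_subtractf axis_def if_distrib[of "\<lambda>x. x * _"] if_distrib[of "\<lambda>x. _ * x"] cong: if_cong)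

lemma skew_elementary: "skew (elementary_skew i j)"
  by (simp add: elementary_skew_def skew_def vec_eq_iff transpose_def)

lemma skew_0 [simp]: "skew 0"
  by (simp add: skew_def vec_eq_iff transpose_def)

lemma skew_add:
  assumes "skew A" "skew B"
  shows "skew (A + B)"
proof -
  have "transpose (A + B) = transpose A + transpose B"
    by (simp add: vec_eq_iff transpose_def)
  then show ?thesis using assms by (simp add: skew_def)
qed

lemma skew_scaleR:
  assumes "skew A"
  shows "skew (r *\<^sub>R A)"
proof -
  have "transpose (r *\<^sub>R A) = r *\<^sub>R transpose A"
    by (simp add: vec_eq_iff transpose_def)
  then show ?thesis using assms by (simp add: skew_def)
qed

text \<open>The six entries above the diagonal determine a skew matrix. The expansion serves twice:
  it puts affine fields into spans of generators, and it reads off a symmetry from the coefficients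
  that survive.\<close>

lemma affine_field_decomp:
  assumes "skew B"
  shows "affine_field A B = A $ 1 *\<^sub>R X 1 + A $ 2 *\<^sub>R X 2 + A $ 3 *\<^sub>R X 3 + A $ 4 *\<^sub>R X 4
    + B $ 1 $ 2 *\<^sub>R R 1 2 + B $ 1 $ 3 *\<^sub>R R 1 3 + B $ 1 $ 4 *\<^sub>R R 1 4
    + B $ 2 $ 3 *\<^sub>R R 2 3 + B $ 2 $ 4 *\<^sub>R R 2 4 + B $ 3 $ 4 *\<^sub>R R 3 4"
  using skewD[OF assms, of 1 2] skewD[OF assms, of 1 3] skewD[OF assms, of 1 4]
    skewD[OF assms, of 2 3] skewD[OF assms, of 2 4] skewD[OF assms, of 3 4] assms
  by (simp add: X_affine R_affine affine_field_add affine_field_scaleR)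
    (simp add: vec_eq_iff forall_4 axis_def elementary_skew_def)

lemma subspace_affine_fields: "subspace {affine_field A B |A B. skew B}"
  unfolding subspace_def
proof (intro conjI ballI allI)
  show "0 \<in> {affine_field A B |A B. skew B}"
    using affine_field_0 skew_0 by (metis (mono_tags, lifting) mem_Collect_eq)
qed (auto simp: affine_field_add affine_field_scaleR intro: skew_add skew_scaleR)

lemma killing_vectors_eq: "killing_vectors = {affine_field A B |A B. skew B}"
proof
  show "killing_vectors \<subseteq> {affine_field A B |A B. skew B}"
    unfolding killing_vectors_def
    by (rule span_minimal[OF _ subspace_affine_fields]) (auto simp: X_affine R_affine intro: skew_elementary)
  show "{affine_field A B |A B. skew B} \<subseteq> killing_vectors"
    unfolding killing_vectors_def
    by clarify (subst affine_field_decomp, assumption,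
      intro span_add span_scale span_base; blast)
qed

lemma translation_vectors_eq: "translation_vectors = range (\<lambda>A. affine_field A 0)"
proof
  have "subspace (range (\<lambda>A. affine_field A 0))"
  proof -
    have "linear (\<lambda>A. affine_field A 0)"
      by (rule linearI) (simp_all add: affine_field_add affine_field_scaleR)
    then show ?thesis by (simp add: linear_subspace_image)
  qed
  then show "translation_vectors \<subseteq> range (\<lambda>A. affine_field A 0)"
    unfolding translation_vectors_def by (rule span_minimal[rotated]) (auto simp: X_affine)
  show "range (\<lambda>A. affine_field A 0) \<subseteq> translation_vectors"
    unfolding translation_vectors_def
    by clarify (subst affine_field_decomp[OF skew_0], simp,
      intro span_add span_scale span_base; blast)
qed

lemma rotation_vectors_eq: "rotation_vectors = {affine_field 0 B |B. skew B}"
proof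
  have "subspace {affine_field 0 B |B. skew B}"
    unfolding subspace_def
  proof (intro conjI ballI allI)
    show "0 \<in> {affine_field 0 B |B. skew B}"
      using affine_field_0 skew_0 by (metis (mono_tags, lifting) mem_Collect_eq)
  qed (auto simp: affine_field_add affine_field_scaleR intro: skew_add skew_scaleR)
  then show "rotation_vectors \<subseteq> {affine_field 0 B |B. skew B}"
    unfolding rotation_vectors_def
    by (rule span_minimal[rotated]) (auto simp: R_affine intro: skew_elementary)
  show "{affine_field 0 B |B. skew B} \<subseteq> rotation_vectors"
    unfolding rotation_vectors_def
    by clarify (subst affine_field_decomp, assumption, simp,
      intro span_add span_scale span_base; blast)
qed

section \<open>Diagonal Killing tensors\<close>

text \<open>Indexing the coefficients by pairs, rather than listing six numbers, lets a permutation
  of the coordinates act by substitution. Symmetry of \<open>c\<close> is a separate hypothesis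
  because only entries above the diagonal occur here.\<close>

definition diag_ten :: "(4 \<Rightarrow> 4 \<Rightarrow> real) \<Rightarrow> tfield" where
  "diag_ten c = c 1 2 *\<^sub>R Rsq 1 2 + c 1 3 *\<^sub>R Rsq 1 3 + c 1 4 *\<^sub>R Rsq 1 4
     + c 2 3 *\<^sub>R Rsq 2 3 + c 2 4 *\<^sub>R Rsq 2 4 + c 3 4 *\<^sub>R Rsq 3 4"

abbreviation symm :: "(4 \<Rightarrow> 4 \<Rightarrow> real) \<Rightarrow> bool" where
  "symm c \<equiv> (\<forall>i j. c i j = c j i)"

lemma Rsq_nth: "Rsq i j x $ k $ l = R i j x $ k * R i j x $ l"
  by (simp add: Rsq_def sym_prod_def)

text \<open>The field \<open>R i j\<close> has the entries \<open>x $ j\<close> and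
  \<open>- x $ i\<close> in places \<open>i\<close> and \<open>j\<close>. Its square therefore adds
  squares of coordinates to two diagonal entries and a mixed product to the entry \<open>i\<close>,
  \<open>j\<close>.\<close>

lemma diag_ten_nth:
  assumes "symm c"
  shows "diag_ten c x $ i $ j =
    (if i = j then (\<Sum>k\<in>UNIV. if k = i then 0 else c i k * (x $ k)\<^sup>2) else - c i j * x $ i * x $ j)"
proof -
  have c: "c 2 1 = c 1 2" "c 3 1 = c 1 3" "c 4 1 = c 1 4" "c 3 2 = c 2 3" "c 4 2 = c 2 4" "c 4 3 = c 3 4"
    using assms by blast+
  have "\<forall>i j. diag_ten c x $ i $ j =
    (if i = j then (\<Sum>k\<in>UNIV. if k = i then 0 else c i k * (x $ k)\<^sup>2) else - c i j * x $ i * x $ j)"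
    by (simp add: diag_ten_def fun_simps Rsq_nth R_def X_def forall_4 sum_4 axis_def c power2_eq_square)
  then show ?thesis by blast
qed

lemma casimir_eq: "casimir = diag_ten (\<lambda>i j. 1)"
  by (simp add: casimir_def diag_ten_def)

lemma diag_ten_shift: "diag_ten c + \<beta> *\<^sub>R casimir = diag_ten (\<lambda>i j. c i j + \<beta>)"
  by (simp add: casimir_eq diag_ten_def scaleR_add_left scaleR_add_right)

lemma diag_ten_in: "diag_ten c \<in> killing_tensors_S3"
  unfolding diag_ten_def killing_tensors_S3_def Rsq_def
  by (intro span_add span_scale span_base; blast)

lemma casimir_nth: "casimir x = ((x \<bullet> x) *\<^sub>R mat 1 - (\<chi> i j. x $ i * x $ j))"
  by (simp add: casimir_eq vec_eq_iff forall_4 diag_ten_nth mat_def inner_vec_def sum_4 power2_eq_square)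

text \<open>On the unit sphere this is the orthogonal projection to the tangent space, so adding a
  multiple of the Casimir tensor shifts all eigenvalues and keeps the eigenvectors.\<close>

lemma casimir_mult_vec: "casimir x *v v = (x \<bullet> x) *\<^sub>R v - (x \<bullet> v) *\<^sub>R x"
  by (simp add: casimir_nth vec_eq_iff forall_4 matrix_vector_mult_def mat_def inner_vec_def sum_4 algebra_simps)

section \<open>Lie derivatives\<close>

lemma affine_has_derivative: "(affine_field A B has_derivative (\<lambda>h. B *v h)) (at x)"
proof -
  have "((\<lambda>x. B *v x) has_derivative (\<lambda>h. B *v h)) (at x)"
    by (simp add: bounded_linear_imp_has_derivative)
  from has_derivative_add[OF has_derivative_const[of A] this] show ?thesis
    by (simp add: affine_field_def[abs_def])
qed

lemma jacobian_affine: "jacobian (affine_field A B) (at x) = B"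
  unfolding jacobian_def frechet_derivative_at[OF affine_has_derivative, symmetric] by simp

lemma lie_deriv_affine:
  assumes "(K has_derivative K') (at x)"
  shows "lie_deriv (affine_field A B) K x = K' (A + B *v x) - B ** K x - K x ** transpose B"
  unfolding lie_deriv_def jacobian_affine frechet_derivative_at[OF assms, symmetric]
  by (simp add: affine_field_def)

lemma has_derivative_quadratic:
  fixes Q :: "'a::euclidean_space \<Rightarrow> 'a \<Rightarrow> 'b::euclidean_space"
  assumes "bilinear Q"
  shows "((\<lambda>x. Q x x) has_derivative (\<lambda>h. Q x h + Q h x)) (at x)"
proof -
  interpret bounded_bilinear Q
    using assms by (simp add: bilinear_conv_bounded_bilinear)
  show ?thesis
    by (rule FDERIV[OF has_derivative_ident has_derivative_ident])
qed

lemma diag_ten_has_derivative: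
  assumes "symm c"
  shows "(diag_ten c has_derivative (\<lambda>h. \<chi> i j.
    if i = j then (\<Sum>k\<in>UNIV. if k = i then 0 else 2 * c i k * x $ k * h $ k)
    else - c i j * (x $ i * h $ j + h $ i * x $ j))) (at x)"
proof -
  \<comment> \<open>A bilinear map with the tensor as its values on the diagonal. It need not be
    symmetric, because the product rule adds both orders of the arguments.\<close>
  define Q :: "real^4 \<Rightarrow> real^4 \<Rightarrow> real^4^4" where
    "Q = (\<lambda>x y. \<chi> i j. if i = j then (\<Sum>k\<in>UNIV. if k = i then 0 else c i k * (x $ k * y $ k))
      else - c i j * x $ i * y $ j)"
  have "bilinear Q"
    unfolding bilinear_def Q_def
    by (intro conjI allI linearI) (simp_all add: vec_eq_iff forall_4 sum_4 algebra_simps)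
  from has_derivative_quadratic[OF this, of x]
  have "((\<lambda>x. Q x x) has_derivative (\<lambda>h. Q x h + Q h x)) (at x)" .
  moreover have "(\<lambda>x. Q x x) = diag_ten c"
    by (simp add: fun_eq_iff vec_eq_iff Q_def diag_ten_nth[OF assms] power2_eq_square cong: if_cong)
  moreover have "(\<lambda>h. Q x h + Q h x) = (\<lambda>h. \<chi> i j.
    if i = j then (\<Sum>k\<in>UNIV. if k = i then 0 else 2 * c i k * x $ k * h $ k)
    else - c i j * (x $ i * h $ j + h $ i * x $ j))"
    by (simp add: fun_eq_iff vec_eq_iff Q_def sum_4 forall_4 algebra_simps)
  ultimately show ?thesis by simp
qed

text \<open>The terms are grouped so that each summand contains a factor whose vanishing characterises the
  symmetries.\<close>

lemma lie_deriv_diag_nth: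
  assumes c: "symm c" and B: "skew B"
  shows "lie_deriv (affine_field A B) (diag_ten c) x $ i $ j =
    (if i = j then (\<Sum>k\<in>UNIV. if k = i then 0 else 2 * x $ k * (c i k * A $ k))
       + (\<Sum>k\<in>UNIV. \<Sum>m\<in>UNIV. if k = i \<or> m = i \<or> k = m then 0
            else x $ k * x $ m * (B $ k $ m * (c i k - c i m)))
     else - (x $ i * (c i j * A $ j)) - x $ j * (c j i * A $ i)
       + (\<Sum>m\<in>UNIV. if m = i \<or> m = j then 0
            else x $ m * x $ j * (B $ i $ m * (c j m - c j i)) + x $ i * x $ m * (B $ j $ m * (c i m - c i j))
              + (x $ m)\<^sup>2 * (B $ i $ j * (c m i - c m j))))"
proof -
  have c': "c 2 1 = c 1 2" "c 3 1 = c 1 3" "c 4 1 = c 1 4" "c 3 2 = c 2 3" "c 4 2 = c 2 4" "c 4 3 = c 3 4"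
    using c by blast+
  note B' = skewD[OF B, of 1 2] skewD[OF B, of 1 3] skewD[OF B, of 1 4]
    skewD[OF B, of 2 3] skewD[OF B, of 2 4] skewD[OF B, of 3 4] skew_diag[OF B]
  note expand = lie_deriv_affine[OF diag_ten_has_derivative[OF c]] matrix_matrix_mult_def
    matrix_vector_mult_def transpose_def diag_ten_nth[OF c] sum_4 c' B' power2_eq_square
  consider "i = 1" | "i = 2" | "i = 3" | "i = 4"
    using exhaust_4 by blast
  then show ?thesis
  proof cases
    case 1
    consider "j = 1" | "j = 2" | "j = 3" | "j = 4"
      using exhaust_4 by blast
    then show ?thesis using 1 by cases (simp_all add: expand, simp_all add: algebra_simps)
  next
    case 2
    consider "j = 1" | "j = 2" | "j = 3" | "j = 4"
      using exhaust_4 by blast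
    then show ?thesis using 2 by cases (simp_all add: expand, simp_all add: algebra_simps)
  next
    case 3
    consider "j = 1" | "j = 2" | "j = 3" | "j = 4"
      using exhaust_4 by blast
    then show ?thesis using 3 by cases (simp_all add: expand, simp_all add: algebra_simps)
  next
    case 4
    consider "j = 1" | "j = 2" | "j = 3" | "j = 4"
      using exhaust_4 by blast
    then show ?thesis using 4 by cases (simp_all add: expand, simp_all add: algebra_simps)
  qed
qed

text \<open>Necessity is read off the diagonal components alone, evaluated at one basis vector or at
  a sum of two. The off-diagonal components then vanish as well, since each of their terms carries
  one of the same factors, up to sign, with the indices renamed.\<close>

lemma lie_deriv_diag_eq_0_iff:
  assumes c: "symm c" and B: "skew B"
  shows "lie_deriv (affine_field A B) (diag_ten c) = 0 \<longleftrightarrow>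
    (\<forall>i k. i \<noteq> k \<longrightarrow> c i k * A $ k = 0) \<and>
    (\<forall>i k m. i \<noteq> k \<longrightarrow> i \<noteq> m \<longrightarrow> k \<noteq> m \<longrightarrow> B $ k $ m * (c i k - c i m) = 0)"
    (is "?L = 0 \<longleftrightarrow> ?P \<and> ?Q")
proof
  assume "?L = 0"
  then have L: "?L x $ i $ i = 0" for x i by (simp add: zero_fun_def)
  have P: "c i k * A $ k = 0" if "i \<noteq> k" for i k
  proof -
    \<comment> \<open>At a basis vector only the linear part survives, because each quadratic term
      contains two different coordinates.\<close>
    have "(\<Sum>l\<in>UNIV. if l = i then 0 else 2 * axis k 1 $ l * (c i l * A $ l))
        = (\<Sum>l\<in>UNIV. if l = k then 2 * (c i k * A $ k) else 0)"
      using that by (intro sum.cong) (auto simp: axis_def)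
    moreover have "(\<Sum>l\<in>UNIV. \<Sum>m\<in>UNIV. if l = i \<or> m = i \<or> l = m then 0
          else axis k 1 $ l * axis k 1 $ m * (B $ l $ m * (c i l - c i m))) = 0"
      by (intro sum.neutral ballI) (simp add: axis_def)
    ultimately show ?thesis
      using L[of "axis k 1" i] unfolding lie_deriv_diag_nth[OF c B] by simp
  qed
  have Q: "B $ k $ m * (c i k - c i m) = 0" if "i \<noteq> k" "i \<noteq> m" "k \<noteq> m" for i k m
  proof -
    \<comment> \<open>Two nonzero coordinates isolate one pair of indices. The ordered pairs
      \<open>k\<close>, \<open>m\<close> and \<open>m\<close>, \<open>k\<close> contribute equally
      by skewness, whence the factor 2 below.\<close>
    define x :: "real^4" where "x = axis k 1 + axis m 1"
    have "(\<Sum>l\<in>UNIV. if l = i then 0 else 2 * x $ l * (c i l * A $ l)) = 0"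
      using P by (intro sum.neutral) auto
    moreover have "(\<Sum>l\<in>UNIV. \<Sum>n\<in>UNIV. if l = i \<or> n = i \<or> l = n then 0
          else x $ l * x $ n * (B $ l $ n * (c i l - c i n)))
       = (\<Sum>l\<in>UNIV. \<Sum>n\<in>UNIV. (if n = m then if l = k then B $ k $ m * (c i k - c i m) else 0 else 0)
          + (if n = k then if l = m then B $ m $ k * (c i m - c i k) else 0 else 0))"
      using that by (intro sum.cong) (auto simp: axis_def x_def)
    moreover have "\<dots> = 2 * (B $ k $ m * (c i k - c i m))"
      using skewD[OF B, of m k] by (simp add: sum.distrib algebra_simps)
    ultimately show ?thesis
      using L[of x i] unfolding lie_deriv_diag_nth[OF c B] by simp
  qed
  show "?P \<and> ?Q" using P Q by blast
next
  assume PQ: "?P \<and> ?Q"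
  then have P: "c i k * A $ k = 0" if "i \<noteq> k" for i k
    using that by blast
  have Q: "B $ k $ m * (c i k - c i m) = 0" if "i \<noteq> k" "i \<noteq> m" "k \<noteq> m" for i k m
    using PQ that by blast
  have "?L x $ i $ j = 0" for x i j
  proof (cases "i = j")
    case True
    have "(\<Sum>k\<in>UNIV. if k = i then 0 else 2 * x $ k * (c i k * A $ k)) = 0"
      by (intro sum.neutral ballI) (simp add: P del: mult_eq_0_iff)
    moreover have "(if k = i \<or> m = i \<or> k = m then 0
        else x $ k * x $ m * (B $ k $ m * (c i k - c i m))) = 0" for k m
      using Q[of i k m] by auto
    ultimately show ?thesis
      unfolding lie_deriv_diag_nth[OF c B] using True by (simp del: mult_eq_0_iff)
  next
    case False
    have "(if m = i \<or> m = j then 0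
        else x $ m * x $ j * (B $ i $ m * (c j m - c j i)) + x $ i * x $ m * (B $ j $ m * (c i m - c i j))
          + (x $ m)\<^sup>2 * (B $ i $ j * (c m i - c m j))) = 0" for m
    proof (cases "m = i \<or> m = j")
      case False
      then have "B $ i $ m * (c j m - c j i) = 0" "B $ j $ m * (c i m - c i j) = 0"
        "B $ i $ j * (c m i - c m j) = 0"
        using \<open>i \<noteq> j\<close> Q[of j i m] Q[of i j m] Q[of m i j] by auto
      then show ?thesis by (simp only: mult_zero_right add_0_left if_cancel)
    qed auto
    then show ?thesis
      unfolding lie_deriv_diag_nth[OF c B] using False P[of i j] P[of j i] by auto
  qed
  then show "?L = 0" by (simp add: fun_eq_iff vec_eq_iff zero_fun_def)
qed

text \<open>The shift \<alpha> cancels in the differences of coefficients, so its quantifier can be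
  confined to the condition on \<open>A\<close>.\<close>

lemma Sym_diag_iff:
  assumes c: "symm c" and B: "skew B"
  shows "affine_field A B \<in> Sym (diag_ten c) \<longleftrightarrow>
    (\<exists>\<alpha>. \<forall>i k. i \<noteq> k \<longrightarrow> (c i k + \<alpha>) * A $ k = 0) \<and>
    (\<forall>i k m. i \<noteq> k \<longrightarrow> i \<noteq> m \<longrightarrow> k \<noteq> m \<longrightarrow> B $ k $ m * (c i k - c i m) = 0)"
proof -
  have "symm (\<lambda>i j. c i j + \<alpha>)" for \<alpha> using c by simp
  then show ?thesis
    unfolding Sym_def diag_ten_shift using B
    by (auto simp: lie_deriv_diag_eq_0_iff killing_vectors_eq simp del: mult_eq_0_iff)
qed

section \<open>The action of rotations\<close>

text \<open>As a rewrite rule it would turn \<open>transpose g *v x\<close> into a row-vector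
  product and hide the cancellations collected next.\<close>

declare transpose_matrix_vector [simp del]

lemma orthogonal_cancel:
  assumes "orthogonal_matrix (g :: real^'n^'n)"
  shows "transpose g ** g = mat 1" "g ** transpose g = mat 1"
    and "M ** transpose g ** g = M" "N ** g ** transpose g = N"
    and "g *v (transpose g *v x) = x" "transpose g *v (g *v x) = x"
proof -
  show *: "transpose g ** g = mat 1" "g ** transpose g = mat 1"
    using assms by (simp_all add: orthogonal_matrix_def)
  show "M ** transpose g ** g = M" "N ** g ** transpose g = N"
    by (simp_all add: matrix_mul_assoc[symmetric] *)
  show "g *v (transpose g *v x) = x" "transpose g *v (g *v x) = x"
    by (simp_all add: matrix_vector_mul_assoc *)
qed

lemma matrix_inv_orthogonal:
  assumes "orthogonal_matrix (g :: real^'n^'n)"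
  shows "matrix_inv g = transpose g"
proof -
  have "g ** matrix_inv g = mat 1 \<and> matrix_inv g ** g = mat 1"
    unfolding matrix_inv_def by (rule someI[of _ "transpose g"]) (simp add: orthogonal_cancel assms)
  then show ?thesis
    by (metis matrix_mul_assoc matrix_mul_lid orthogonal_cancel(4)[OF assms])
qed

lemma orthogonal_inner:
  assumes "orthogonal_matrix (g :: real^'n^'n)"
  shows "(g *v x) \<bullet> (g *v y) = x \<bullet> y"
proof -
  have "(g *v x) \<bullet> (g *v y) = (transpose g *v (g *v x)) \<bullet> y"
    by (simp only: transpose_matrix_vector dot_lmul_matrix)
  then show ?thesis by (simp add: orthogonal_cancel assms)
qed

lemma orthogonal_inner_left:
  assumes "orthogonal_matrix (g :: real^'n^'n)"
  shows "(g *v x) \<bullet> y = x \<bullet> (transpose g *v y)"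
  using orthogonal_inner[OF assms, of x "transpose g *v y"] by (simp add: orthogonal_cancel assms)

lemma orthogonal_sphere:
  assumes "orthogonal_matrix (g :: real^'n^'n)"
  shows "g *v x \<in> sphere 0 1 \<longleftrightarrow> x \<in> sphere 0 1"
  by (simp add: norm_eq_sqrt_inner orthogonal_inner assms)

lemma rotation_matrix_orthogonal: "rotation_matrix g \<Longrightarrow> orthogonal_matrix g"
  by (simp add: rotation_matrix_def)

lemma rotation_matrix_transpose: "rotation_matrix (g :: real^'n^'n) \<Longrightarrow> rotation_matrix (transpose g)"
  by (simp add: rotation_matrix_def orthogonal_matrix_transpose det_transpose)

lemma rotation_matrix_mult: "rotation_matrix (g :: real^'n^'n) \<Longrightarrow> rotation_matrix h \<Longrightarrow> rotation_matrix (g ** h)"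
  by (simp add: rotation_matrix_def orthogonal_matrix_mul det_mul)

lemma linear_conjugation: "linear (\<lambda>M::real^4^4. g ** M ** transpose g)"
  by (intro linearI)
    (simp_all add: vec_eq_iff matrix_matrix_mult_def sum_4 algebra_simps)

lemma push_ten_orthogonal:
  "orthogonal_matrix g \<Longrightarrow> push_ten g K = (\<lambda>x. g ** K (transpose g *v x) ** transpose g)"
  by (simp add: push_ten_def matrix_inv_orthogonal)

lemma push_ten_add: "push_ten g (K + L) = push_ten g K + push_ten g L"
  and push_ten_scaleR: "push_ten g (r *\<^sub>R K) = r *\<^sub>R push_ten g K"
  by (simp_all add: push_ten_def fun_simps linear_add[OF linear_conjugation] linear_scale[OF linear_conjugation])

lemma push_ten_0: "push_ten g 0 = 0"
  using push_ten_scaleR[of g 0 0] by simp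

lemma push_ten_mult:
  assumes "orthogonal_matrix g" "orthogonal_matrix h"
  shows "push_ten g (push_ten h K) = push_ten (g ** h) K"
  using assms
  by (simp add: push_ten_orthogonal orthogonal_matrix_mul matrix_transpose_mul
      matrix_mul_assoc matrix_vector_mul_assoc)

lemma push_ten_id: "push_ten (mat 1) K = K"
  by (simp add: push_ten_orthogonal orthogonal_matrix_id transpose_mat)

lemma push_vec_affine:
  assumes "orthogonal_matrix g"
  shows "push_vec g (affine_field A B) = affine_field (g *v A) (g ** B ** transpose g)"
  using assms
  by (simp add: push_vec_def affine_field_def matrix_inv_orthogonal matrix_vector_right_distrib
      matrix_vector_mul_assoc matrix_mul_assoc)

lemma skew_conjugation:
  assumes "skew B"
  shows "skew (g ** B ** transpose g)"
proof -
  have "transpose (g ** B ** transpose g) = g ** (- B) ** transpose g"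
    using assms by (simp add: skew_def matrix_transpose_mul matrix_mul_assoc)
  then show ?thesis
    using linear_neg[OF linear_conjugation, of g B] by (simp add: skew_def)
qed

text \<open>The action of the Casimir tensor on vectors is expressed through inner products alone,
  and these are preserved by \<open>g\<close>.\<close>

lemma push_ten_casimir:
  assumes "orthogonal_matrix g"
  shows "push_ten g casimir = casimir"
proof -
  have "push_ten g casimir x *v v = casimir x *v v" for x v
    using assms
    by (simp add: push_ten_orthogonal matrix_vector_mul_assoc[symmetric] casimir_mult_vec
        matrix_vector_mult_diff_distrib matrix_vector_mult_scaleR orthogonal_cancel
        orthogonal_inner orthogonal_matrix_transpose)
  then show ?thesis by (simp add: fun_eq_iff matrix_eq)
qed

section \<open>Invariance and differentiability of the Killing tensors of the sphere\<close>

lemma push_vec_R: "push_vec g (R i j) \<in> rotation_vectors" if "orthogonal_matrix g"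
  using that by (auto simp: R_affine push_vec_affine rotation_vectors_eq intro: skew_conjugation skew_elementary)

lemma push_ten_sym_prod: "push_ten g (V \<odot> W) = push_vec g V \<odot> push_vec g W"
  by (simp add: fun_eq_iff push_ten_def push_vec_def sym_prod_def vec_eq_iff
      matrix_matrix_mult_def matrix_vector_mult_def transpose_def sum_4)
    (simp add: field_simps)

lemma sym_prod_add_left: "(V + V') \<odot> W = V \<odot> W + V' \<odot> W"
  and sym_prod_scaleR_left: "(r *\<^sub>R V) \<odot> W = r *\<^sub>R (V \<odot> W)"
  and sym_prod_commute: "V \<odot> W = W \<odot> V"
  by (simp_all add: sym_prod_def fun_simps fun_eq_iff vec_eq_iff field_simps)

lemma sym_prod_0_left: "0 \<odot> W = 0"
  using sym_prod_scaleR_left[of 0 0 W] by simp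

text \<open>Pushing a generator forward gives a product of two general rotation vectors, no longer
  of two \<open>R i j\<close>. Bilinearity brings it back into the span: one factor is treated at a
  time, and commutativity exchanges their roles.\<close>

lemma sym_prod_rotation_vectors:
  assumes "V \<in> rotation_vectors" "W \<in> rotation_vectors"
  shows "V \<odot> W \<in> killing_tensors_S3"
proof -
  have sub: "subspace {V. V \<odot> W \<in> killing_tensors_S3}" for W
    unfolding subspace_def killing_tensors_S3_def
    by (auto simp: sym_prod_0_left sym_prod_add_left sym_prod_scaleR_left intro: span_zero span_add span_scale)
  have "R i j \<odot> W \<in> killing_tensors_S3" if "W \<in> rotation_vectors" for i j W
  proof -
    have "rotation_vectors \<subseteq> {W. W \<odot> R i j \<in> killing_tensors_S3}"
      unfolding rotation_vectors_def
      by (rule span_minimal[OF _ sub]) (auto simp: killing_tensors_S3_def intro!: span_base)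
    then show ?thesis using that by (auto simp: sym_prod_commute)
  qed
  then have "rotation_vectors \<subseteq> {V. V \<odot> W \<in> killing_tensors_S3}"
    using assms(2) unfolding rotation_vectors_def
    by (intro span_minimal[OF _ sub]) auto
  then show ?thesis using assms(1) by blast
qed

lemma push_ten_killing_tensors:
  assumes "orthogonal_matrix g" "K \<in> killing_tensors_S3"
  shows "push_ten g K \<in> killing_tensors_S3"
proof -
  have "subspace {K. push_ten g K \<in> killing_tensors_S3}"
    unfolding subspace_def killing_tensors_S3_def
    by (auto simp: push_ten_0 push_ten_add push_ten_scaleR intro: span_zero span_add span_scale)
  moreover have "push_ten g (R i j \<odot> R k l) \<in> killing_tensors_S3" for i j k l
    using assms(1) by (simp add: push_ten_sym_prod push_vec_R sym_prod_rotation_vectors)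
  ultimately have "span {R i j \<odot> R k l |i j k l. True} \<subseteq> {K. push_ten g K \<in> killing_tensors_S3}"
    by (intro span_minimal) auto
  then show ?thesis using assms(2) unfolding killing_tensors_S3_def by blast
qed

lemma killing_tensors_shift:
  "K \<in> killing_tensors_S3 \<Longrightarrow> K + \<beta> *\<^sub>R casimir \<in> killing_tensors_S3"
  using diag_ten_in[of "\<lambda>i j. 1"]
  unfolding casimir_eq killing_tensors_S3_def by (intro span_add span_scale)

text \<open>The chain rule for \<open>lie_deriv\<close> needs an actual derivative, and a CKT that
  is merely equivalent to a canonical one need not be diagonal. Differentiability is therefore
  checked on the generators, which are quadratic.\<close>

lemma killing_tensor_differentiable:
  assumes "K \<in> killing_tensors_S3"
  shows "K differentiable (at x)"
proof -
  have "R i j \<odot> R k l differentiable (at x)" for i j k l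
  proof -
    define Q :: "real^4 \<Rightarrow> real^4 \<Rightarrow> real^4^4" where
      "Q = (\<lambda>x y. \<chi> m n. (R i j x $ m * R k l y $ n + R i j x $ n * R k l y $ m) / 2)"
    have "bilinear Q"
      unfolding bilinear_def Q_def R_def X_def
      by (intro conjI allI linearI) (simp_all add: vec_eq_iff field_simps)
    from has_derivative_quadratic[OF this] show ?thesis
      by (auto simp: differentiable_def Q_def sym_prod_def)
  qed
  moreover have "subspace {K :: tfield. K differentiable (at x)}"
    unfolding subspace_def
    by (auto simp: plus_fun_def zero_fun_def scaleR_fun_def intro!: derivative_intros)
  ultimately have "killing_tensors_S3 \<subseteq> {K. K differentiable (at x)}"
    unfolding killing_tensors_S3_def by (intro span_minimal) auto
  then show ?thesis using assms by blast
qed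

section \<open>Invariance of characteristic Killing tensors\<close>

lemma eigenpair_push:
  assumes "orthogonal_matrix g"
  shows "eigenpair (push_ten g K) (g *v x) l (g *v v) \<longleftrightarrow> eigenpair K x l v"
proof -
  have inj: "g *v u = g *v w \<longleftrightarrow> u = w" for u w
    using orthogonal_cancel(6)[OF assms] by metis
  have "push_ten g K (g *v x) *v (g *v v) = g *v (K x *v v)"
    using assms by (simp add: push_ten_orthogonal matrix_vector_mul_assoc orthogonal_cancel
        flip: matrix_vector_mul_assoc[of _ g v] matrix_vector_mul_assoc[of _ _ "g *v v"])
  moreover have "l *\<^sub>R (g *v v) = g *v (l *\<^sub>R v)"
    by (simp add: matrix_vector_mult_scaleR)
  moreover have "g *v v = 0 \<longleftrightarrow> v = 0"
    using inj[of v 0] by simp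
  ultimately show ?thesis
    by (simp only: eigenpair_def orthogonal_inner[OF assms] inj)
qed

lemma simple_at_push:
  assumes "orthogonal_matrix g"
  shows "simple_at (push_ten g K) (g *v x) \<longleftrightarrow> simple_at K x"
proof -
  have "(\<exists>v. eigenpair (push_ten g K) (g *v x) l v) \<longleftrightarrow> (\<exists>v. eigenpair K x l v)" for l
    using eigenpair_push[OF assms, of K x l] orthogonal_cancel(5)[OF assms] by metis
  then show ?thesis by (simp add: simple_at_def)
qed

lemma tangential_orthogonal:
  "orthogonal_matrix g \<Longrightarrow> tangential (g *v x) (g *v v) = g *v tangential x v"
  by (simp add: tangential_def orthogonal_inner matrix_vector_mult_diff_distrib matrix_vector_mult_scaleR)

text \<open>The potential \<open>u\<close> is transported to its composition with
  \<open>transpose g\<close>. Its gradient is then \<open>g\<close> applied to the old gradient at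
  the preimage, and \<open>g\<close> commutes with projection to the tangent space.\<close>

lemma normal_at_push:
  assumes g: "orthogonal_matrix g" and "normal_at K p v"
  shows "normal_at (push_ten g K) (g *v p) (g *v v)"
proof -
  obtain U u G s where U: "open U" "p \<in> U" "continuous_on U G"
    and u: "\<And>x. x \<in> U \<Longrightarrow> (u has_derivative (\<lambda>h. G x \<bullet> h)) (at x)"
    and ev: "\<And>x. x \<in> U \<inter> sphere 0 1 \<Longrightarrow> \<exists>l. eigenpair K x l (tangential x (G x))"
    and s: "tangential p (G p) = s *\<^sub>R v"
    using assms(2) unfolding normal_at_def by metis
  let ?h = "transpose g"
  note c = orthogonal_cancel[OF g]
  define U' where "U' = (\<lambda>x. ?h *v x) -` U"
  define G' where "G' = (\<lambda>x. g *v G (?h *v x))"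
  have "open U'"
    unfolding U'_def using U(1) by (intro continuous_open_vimage) (auto intro!: continuous_intros)
  moreover have "g *v p \<in> U'"
    using U(2) by (simp add: U'_def c)
  moreover have "continuous_on U' G'"
  proof -
    have "continuous_on U' (\<lambda>x. G (?h *v x))"
      by (rule continuous_on_compose2[OF U(3)]) (auto simp: U'_def intro!: continuous_intros)
    then show ?thesis
      unfolding G'_def by (rule continuous_on_compose2[OF matrix_vector_mult_linear_continuous_on]) auto
  qed
  moreover have "((\<lambda>x. u (?h *v x)) has_derivative (\<lambda>h. G' x \<bullet> h)) (at x)" if "x \<in> U'" for x
  proof -
    have "((\<lambda>x. ?h *v x) has_derivative (\<lambda>x. ?h *v x)) (at x)"
      by (simp add: bounded_linear_imp_has_derivative)
    from has_derivative_compose[OF this u] that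
    have "((\<lambda>x. u (?h *v x)) has_derivative (\<lambda>h. G (?h *v x) \<bullet> (?h *v h))) (at x)"
      by (simp add: U'_def)
    then show ?thesis
      by (simp add: G'_def orthogonal_inner_left[OF g])
  qed
  moreover have "\<exists>l. eigenpair (push_ten g K) x l (tangential x (G' x))" if x: "x \<in> U' \<inter> sphere 0 1" for x
  proof -
    let ?y = "?h *v x"
    have "x = g *v ?y" by (simp add: c)
    have "?y \<in> sphere 0 1"
      using that orthogonal_sphere[of ?h x] g by (simp add: orthogonal_matrix_transpose)
    then obtain l where "eigenpair K ?y l (tangential ?y (G ?y))"
      using ev[of ?y] x by (auto simp: U'_def)
    then have "eigenpair (push_ten g K) (g *v ?y) l (tangential (g *v ?y) (g *v G ?y))"
      by (simp add: eigenpair_push g tangential_orthogonal)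
    then show ?thesis
      by (auto simp: c G'_def)
  qed
  moreover have "tangential (g *v p) (G' (g *v p)) = s *\<^sub>R (g *v v)"
    by (simp add: G'_def c tangential_orthogonal g s matrix_vector_mult_scaleR)
  ultimately show ?thesis
    unfolding normal_at_def by (intro exI[of _ U'] exI[of _ "\<lambda>x. u (?h *v x)"] exI[of _ G']) blast
qed

lemma CKT_push:
  assumes g: "orthogonal_matrix g" and K: "CKT K"
  shows "CKT (push_ten g K)"
  unfolding CKT_def
proof (intro conjI ballI impI allI)
  note c = orthogonal_cancel[OF g]
  show "push_ten g K \<in> killing_tensors_S3"
    using K g by (simp add: CKT_def push_ten_killing_tensors)
  let ?S = "{x \<in> sphere 0 1. simple_at K x}" and ?S' = "{x \<in> sphere 0 1. simple_at (push_ten g K) x}"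
  have inv_sphere: "transpose g *v x \<in> sphere 0 1" if "x \<in> sphere 0 1" for x
    using that orthogonal_sphere[of "transpose g" x] g by (simp add: orthogonal_matrix_transpose)
  \<comment> \<open>A continuous map sends a closure into the closure of the image. Since
    \<open>g\<close> maps the sphere onto itself, density of the simple points is inherited.\<close>
  have "(\<lambda>x. g *v x) ` closure ?S \<subseteq> closure ?S'"
  proof (rule image_closure_subset)
    show "(\<lambda>x. g *v x) ` ?S \<subseteq> closure ?S'"
      using orthogonal_sphere[OF g] by (auto simp: simple_at_push g intro!: closure_subset[THEN subsetD])
  qed (auto intro!: continuous_intros)
  then show "sphere 0 1 \<subseteq> closure ?S'"
    using K inv_sphere c(5) unfolding CKT_def by (metis (no_types, lifting) image_eqI subset_iff)
  fix p l v
  assume p: "p \<in> sphere 0 1" "simple_at (push_ten g K) p" "eigenpair (push_ten g K) p l v"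
  let ?q = "transpose g *v p" and ?w = "transpose g *v v"
  have "simple_at K ?q" "eigenpair K ?q l ?w"
    using p(2,3) simple_at_push[OF g, of K ?q] eigenpair_push[OF g, of K ?q l ?w] by (simp_all add: c)
  then have "normal_at K ?q ?w"
    using K inv_sphere[OF p(1)] unfolding CKT_def by blast
  from normal_at_push[OF g this] show "normal_at (push_ten g K) p v"
    by (simp add: c)
qed

lemma eigenpair_shift:
  assumes "x \<in> sphere 0 1"
  shows "eigenpair (K + \<beta> *\<^sub>R casimir) x l v \<longleftrightarrow> eigenpair K x (l - \<beta>) v"
proof -
  have "x \<bullet> x = 1" using assms by (simp add: norm_eq_sqrt_inner)
  then have "(K + \<beta> *\<^sub>R casimir) x *v v = K x *v v + \<beta> *\<^sub>R v" if "x \<bullet> v = 0"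
    using that by (simp add: fun_simps matrix_vector_mult_add_rdistrib casimir_mult_vec
        flip: scaleR_matrix_vector_assoc)
  then show ?thesis by (auto simp: eigenpair_def algebra_simps)
qed

lemma simple_at_shift:
  assumes "x \<in> sphere 0 1"
  shows "simple_at (K + \<beta> *\<^sub>R casimir) x \<longleftrightarrow> simple_at K x"
proof -
  have "{l. \<exists>v. eigenpair (K + \<beta> *\<^sub>R casimir) x l v} = (\<lambda>l. l + \<beta>) ` {l. \<exists>v. eigenpair K x l v}"
    by (auto simp: eigenpair_shift[OF assms] image_iff intro!: exI[of _ "_ - \<beta>"])
  then show ?thesis by (simp add: simple_at_def card_image)
qed

lemma CKT_shift:
  assumes K: "CKT K"
  shows "CKT (K + \<beta> *\<^sub>R casimir)"
proof -
  have "{x \<in> sphere 0 1. simple_at (K + \<beta> *\<^sub>R casimir) x} = {x \<in> sphere 0 1. simple_at K x}"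
    using simple_at_shift by blast
  moreover have "normal_at (K + \<beta> *\<^sub>R casimir) p v" if "normal_at K p v" for p v
  proof -
    \<comment> \<open>Only the eigenvalue changes under the shift, so the same potential and
      gradient serve for the shifted tensor.\<close>
    have ex: "(\<exists>l. eigenpair (K + \<beta> *\<^sub>R casimir) x l w) \<longleftrightarrow> (\<exists>l. eigenpair K x l w)"
      if "x \<in> sphere 0 1" for x w
      unfolding eigenpair_shift[OF that] by (metis add_diff_cancel_right')
    have "(\<forall>x \<in> U \<inter> sphere 0 1. \<exists>l. eigenpair (K + \<beta> *\<^sub>R casimir) x l (f x)) \<longleftrightarrow>
        (\<forall>x \<in> U \<inter> sphere 0 1. \<exists>l. eigenpair K x l (f x))" for U f
      by (intro ball_cong refl ex) simp
    then show ?thesis using that unfolding normal_at_def by simp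
  qed
  ultimately show ?thesis
    using K unfolding CKT_def
    by (auto simp: simple_at_shift eigenpair_shift killing_tensors_shift)
qed

section \<open>Equivalence modulo rotations and the Casimir tensor\<close>

lemma equivalent_CKT: "equivalent K K' \<Longrightarrow> CKT K \<Longrightarrow> CKT K'"
  unfolding equivalent_def using CKT_push CKT_shift rotation_matrix_orthogonal by blast

lemma equivalent_refl: "equivalent K K"
  unfolding equivalent_def
  by (intro exI[of _ "mat 1"] exI[of _ 0])
    (simp add: push_ten_id rotation_matrix_def orthogonal_matrix_id)

lemma equivalent_shift: "equivalent K (K + \<beta> *\<^sub>R casimir)"
  unfolding equivalent_def
  by (intro exI[of _ "mat 1"] exI[of _ \<beta>])
    (simp add: push_ten_id rotation_matrix_def orthogonal_matrix_id)

text \<open>The rotations compose, and the multiples of the Casimir tensor add because the second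
  rotation fixes that tensor.\<close>

lemma equivalent_trans:
  assumes "equivalent K L" "equivalent L M"
  shows "equivalent K M"
proof -
  obtain g \<beta> h \<gamma> where gh: "rotation_matrix g" "rotation_matrix h"
    and L: "L = push_ten g K + \<beta> *\<^sub>R casimir" and M: "M = push_ten h L + \<gamma> *\<^sub>R casimir"
    using assms unfolding equivalent_def by blast
  then have "M = push_ten (h ** g) K + (\<beta> + \<gamma>) *\<^sub>R casimir"
    by (simp add: push_ten_add push_ten_scaleR push_ten_casimir push_ten_mult
        rotation_matrix_orthogonal scaleR_add_left)
  then show ?thesis
    unfolding equivalent_def using rotation_matrix_mult gh by blast
qed

lemma equivalent_sym:
  assumes "equivalent K L"
  shows "equivalent L K"
proof -
  obtain g \<beta> where g: "rotation_matrix g" and L: "L = push_ten g K + \<beta> *\<^sub>R casimir"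
    using assms unfolding equivalent_def by blast
  note o = rotation_matrix_orthogonal[OF g] rotation_matrix_orthogonal[OF rotation_matrix_transpose[OF g]]
  have "K = push_ten (transpose g) L + (- \<beta>) *\<^sub>R casimir"
    using o by (simp add: L push_ten_add push_ten_scaleR push_ten_casimir push_ten_mult
        orthogonal_cancel push_ten_id)
  then show ?thesis
    unfolding equivalent_def using rotation_matrix_transpose[OF g] by blast
qed

section \<open>Invariance of the symmetries\<close>

text \<open>Naturality of the Lie derivative. Here it follows from the chain rule, because
  conjugation by \<open>g\<close> is linear and \<open>transpose g ** g\<close> cancels between the
  factors.\<close>

lemma lie_deriv_push:
  assumes g: "orthogonal_matrix g" and K: "\<And>x. K differentiable (at x)"
  shows "lie_deriv (push_vec g (affine_field A B)) (push_ten g K)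
    = push_ten g (lie_deriv (affine_field A B) K)"
proof
  fix x
  note c = orthogonal_cancel[OF g]
  let ?y = "transpose g *v x" and ?con = "\<lambda>M::real^4^4. g ** M ** transpose g"
  obtain K' where K': "(K has_derivative K') (at ?y)"
    using K by (auto simp: differentiable_def)
  have "((\<lambda>x. transpose g *v x) has_derivative (\<lambda>x. transpose g *v x)) (at x)"
    by (simp add: bounded_linear_imp_has_derivative)
  then have "((\<lambda>x. K (transpose g *v x)) has_derivative (\<lambda>h. K' (transpose g *v h))) (at x)"
    using K' by (rule has_derivative_compose)
  then have "((\<lambda>x. ?con (K (transpose g *v x))) has_derivative (\<lambda>h. ?con (K' (transpose g *v h)))) (at x)"
    by (rule bounded_linear.has_derivative[OF linear_conv_bounded_linear[THEN iffD1, OF linear_conjugation]])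
  then have "(push_ten g K has_derivative (\<lambda>h. ?con (K' (transpose g *v h)))) (at x)"
    by (simp add: push_ten_orthogonal g)
  from lie_deriv_affine[OF this] show "lie_deriv (push_vec g (affine_field A B)) (push_ten g K) x
      = push_ten g (lie_deriv (affine_field A B) K) x"
    by (simp add: push_vec_affine g push_ten_orthogonal lie_deriv_affine[OF K'] matrix_transpose_mul
        matrix_vector_right_distrib matrix_vector_mul_assoc matrix_mul_assoc c
        linear_diff[OF linear_conjugation])
qed

lemma push_vec_Sym:
  assumes g: "orthogonal_matrix g" and K: "K \<in> killing_tensors_S3" and V: "V \<in> Sym K"
  shows "push_vec g V \<in> Sym (push_ten g K + \<beta> *\<^sub>R casimir)"
proof -
  obtain \<alpha> where \<alpha>: "lie_deriv V (K + \<alpha> *\<^sub>R casimir) = 0"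
    using V by (auto simp: Sym_def)
  obtain A B where AB: "V = affine_field A B" "skew B"
    using V by (auto simp: Sym_def killing_vectors_eq)
  have "lie_deriv (push_vec g V) (push_ten g (K + \<alpha> *\<^sub>R casimir)) = 0"
    using lie_deriv_push[OF g killing_tensor_differentiable[OF killing_tensors_shift[OF K]]] \<alpha>
    by (simp add: AB(1) push_ten_0)
  \<comment> \<open>The shift \<beta> already present in the new tensor is subtracted from the
    multiple that worked for \<open>V\<close>.\<close>
  moreover have "push_ten g (K + \<alpha> *\<^sub>R casimir)
      = push_ten g K + \<beta> *\<^sub>R casimir + (\<alpha> - \<beta>) *\<^sub>R casimir"
    by (simp add: push_ten_add push_ten_scaleR push_ten_casimir[OF g] scaleR_diff_left)
  moreover have "push_vec g V \<in> killing_vectors"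
    using AB by (auto simp: killing_vectors_eq push_vec_affine g skew_conjugation)
  ultimately show ?thesis
    unfolding Sym_def by auto
qed

lemma push_vec_inverse:
  assumes "orthogonal_matrix g"
  shows "push_vec (transpose g) (push_vec g V) = V" "push_vec g (push_vec (transpose g) V) = V"
  using assms
  by (simp_all add: push_vec_def matrix_inv_orthogonal orthogonal_matrix_transpose
      transpose_transpose orthogonal_cancel)

lemma linear_push_vec: "linear (push_vec g)"
  by (rule linearI)
    (simp_all add: push_vec_def fun_simps matrix_vector_right_distrib matrix_vector_mult_scaleR)

text \<open>Stated for arbitrary real vector spaces because the vector fields form an
  infinite-dimensional one. An injective linear map carries a basis of the span to a basis of the
  span of the image.\<close>

lemma dim_image_inj:
  fixes f :: "'a::real_vector \<Rightarrow> 'b::real_vector"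
  assumes "linear f" "inj f"
  shows "dim (f ` S) = dim S"
proof -
  obtain B where B: "B \<subseteq> S" "independent B" "S \<subseteq> span B" "card B = dim S"
    by (rule real_vector.basis_exists)
  have "span B = span S"
    using B(1,3) by (metis span_mono span_span subset_antisym)
  then have "span (f ` B) = span (f ` S)"
    using assms(1) by (simp add: real_vector.linear_span_image)
  moreover have "independent (f ` B)"
    using real_vector.linear_independent_injective_image[OF assms(1) B(2)] inj_on_subset[OF assms(2)] by simp
  ultimately have "dim (f ` S) = card (f ` B)"
    by (rule real_vector.dim_eq_card)
  then show ?thesis
    using B(4) card_image[OF inj_on_subset[OF assms(2)], of B] by simp
qed

lemma push_vec_translation: "orthogonal_matrix g \<Longrightarrow> V \<in> translation_vectors \<Longrightarrow> push_vec g V \<in> translation_vectors"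
  by (auto simp: translation_vectors_eq push_vec_affine)

lemma push_vec_rotation: "orthogonal_matrix g \<Longrightarrow> V \<in> rotation_vectors \<Longrightarrow> push_vec g V \<in> rotation_vectors"
  by (auto simp: rotation_vectors_eq push_vec_affine skew_conjugation)

text \<open>The set \<open>T\<close> stands for the translations or the rotations. Push-forward by
  \<open>g\<close> maps the symmetries in \<open>T\<close> bijectively, with push-forward by
  \<open>transpose g\<close> as its inverse.\<close>

lemma equivalent_dim_Sym:
  assumes eq: "equivalent K K'" and K: "K \<in> killing_tensors_S3"
    and T: "\<And>g V. orthogonal_matrix g \<Longrightarrow> V \<in> T \<Longrightarrow> push_vec g V \<in> T"
  shows "dim (Sym K \<inter> T) = dim (Sym K' \<inter> T)"
proof -
  obtain g \<beta> where "rotation_matrix g" and K': "K' = push_ten g K + \<beta> *\<^sub>R casimir"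
    using eq unfolding equivalent_def by blast
  then have g: "orthogonal_matrix g" and g': "orthogonal_matrix (transpose g)"
    by (simp_all add: rotation_matrix_orthogonal rotation_matrix_transpose)
  have "K' \<in> killing_tensors_S3"
    using K K' g by (simp add: killing_tensors_shift push_ten_killing_tensors)
  moreover have "K = push_ten (transpose g) K' + (- \<beta>) *\<^sub>R casimir"
    using g g' by (simp add: K' push_ten_add push_ten_scaleR push_ten_casimir push_ten_mult
        orthogonal_cancel push_ten_id)
  ultimately have "push_vec (transpose g) V \<in> Sym K" if "V \<in> Sym K'" for V
    using push_vec_Sym[OF g' _ that] by metis
  moreover have "push_vec g V \<in> Sym K'" if "V \<in> Sym K" for V
    using push_vec_Sym[OF g K that] K' by simp
  ultimately have "push_vec g ` (Sym K \<inter> T) = Sym K' \<inter> T"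
    using T[OF g] T[OF g'] push_vec_inverse[OF g] by (auto 4 3 simp: image_iff) (metis IntI)
  moreover have "inj (push_vec g)"
    using push_vec_inverse(1)[OF g] by (metis injI)
  ultimately show ?thesis
    using dim_image_inj[OF linear_push_vec] by metis
qed

lemma equivalent_counts:
  assumes "equivalent K K'" "CKT K"
  shows "n_translations K = n_translations K'" "n_rotations K = n_rotations K'"
  using assms equivalent_dim_Sym push_vec_translation push_vec_rotation
  by (simp_all add: n_translations_def n_rotations_def CKT_def)

section \<open>Permutation of the coordinates\<close>

lemma permutation_rotation:
  assumes p: "p permutes (UNIV :: 'n::finite set)"
  obtains g :: "real^'n^'n" and s :: "'n \<Rightarrow> real" where "rotation_matrix g"
    "\<And>i j. g $ i $ j = (if p i = j then s j else 0)" "\<And>i. s i * s i = 1"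
proof -
  obtain a :: 'n where True by simp
  \<comment> \<open>An odd permutation matrix has determinant -1; changing the sign of the single
    coordinate \<open>a\<close> makes it a rotation.\<close>
  define s :: "'n \<Rightarrow> real" where "s = (\<lambda>i. if i = a then of_int (sign p) else 1)"
  have s: "s i * s i = 1" for i
    by (simp add: s_def sign_def)
  define A :: "real^'n^'n" where "A = (\<chi> i j. if i = j then s j else 0)"
  define g :: "real^'n^'n" where "g = (\<chi> i. A $ p i)"
  have g: "g $ i $ j = (if p i = j then s j else 0)" for i j
    by (simp add: g_def A_def)
  have "det A = of_int (sign p)"
    by (subst det_diagonal) (simp_all add: A_def s_def)
  then have "det g = 1"
    unfolding g_def det_permute_rows[OF p] by (simp add: sign_def)
  moreover have "g ** transpose g = mat 1"
    using permutes_inj[OF p]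
    by (auto simp: vec_eq_iff matrix_matrix_mult_def transpose_def g mat_def s inj_eq
        if_distrib[of "\<lambda>x. x * _"] if_distrib[of "\<lambda>x. _ * x"] cong: if_cong)
  ultimately have "rotation_matrix g"
    by (simp add: rotation_matrix_def orthogonal_matrix matrix_left_right_inverse)
  then show thesis using g s that by blast
qed

text \<open>The signs in \<open>g\<close> leave no trace: in a diagonal entry coordinates occur
  squared, and in an off-diagonal entry the signs from the conjugation meet those from the
  coordinates.\<close>

lemma diag_ten_permute:
  assumes p: "p permutes UNIV" and c: "symm c"
  shows "equivalent (diag_ten c) (diag_ten (\<lambda>i j. c (p i) (p j)))"
proof -
  obtain g :: "real^4^4" and s :: "4 \<Rightarrow> real" where "rotation_matrix g"
    and g: "\<And>i j. g $ i $ j = (if p i = j then s j else 0)" and s: "\<And>i. s i * s i = 1"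
    using permutation_rotation[OF p] by metis
  then have o: "orthogonal_matrix g" by (simp add: rotation_matrix_orthogonal)
  have inj: "p i = p j \<longleftrightarrow> i = j" for i j
    using permutes_inj[OF p] by (simp add: inj_eq)
  have y: "(transpose g *v x) $ p i = s (p i) * x $ i" for x i
    by (simp add: matrix_vector_mult_def transpose_def g inj if_distrib[of "\<lambda>x. x * _"] cong: if_cong)
  have y2: "((transpose g *v x) $ p i)\<^sup>2 = (x $ i)\<^sup>2" for x i
    using s[of "p i"] by (simp add: y power_mult_distrib power2_eq_square)
  have con: "(g ** M ** transpose g) $ i $ j = s (p i) * s (p j) * M $ p i $ p j" for M i j
    by (simp add: matrix_matrix_mult_def transpose_def g if_distrib[of "\<lambda>x. x * _"]
        if_distrib[of "\<lambda>x. _ * x"] cong: if_cong)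
  have c': "symm (\<lambda>i j. c (p i) (p j))" using c by blast
  have "push_ten g (diag_ten c) x $ i $ j = diag_ten (\<lambda>i j. c (p i) (p j)) x $ i $ j" for x i j
  proof (cases "i = j")
    case True
    have "(\<Sum>k\<in>UNIV. if k = p i then 0 else c (p i) k * ((transpose g *v x) $ k)\<^sup>2)
        = (\<Sum>k\<in>UNIV. if k = i then 0 else c (p i) (p k) * (x $ k)\<^sup>2)"
      by (subst sum.permute[OF p]) (simp add: comp_def inj y2 cong: if_cong)
    then show ?thesis
      unfolding True[symmetric]
      by (simp add: push_ten_orthogonal[OF o] con diag_ten_nth[OF c] diag_ten_nth[OF c'] s)
  next
    case False
    have "s (p i) * s (p j) * (c (p i) (p j) * (s (p i) * x $ i) * (s (p j) * x $ j))
        = (s (p i) * s (p i)) * (s (p j) * s (p j)) * (c (p i) (p j) * x $ i * x $ j)"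
      by (simp only: ac_simps)
    with False show ?thesis
      by (simp add: push_ten_orthogonal[OF o] con diag_ten_nth[OF c] diag_ten_nth[OF c'] y inj s)
  qed
  then have "diag_ten (\<lambda>i j. c (p i) (p j)) = push_ten g (diag_ten c) + 0 *\<^sub>R casimir"
    by (simp add: fun_eq_iff vec_eq_iff)
  then show ?thesis
    unfolding equivalent_def using \<open>rotation_matrix g\<close> by blast
qed

lemma permutation_of_distinct:
  fixes i j k l :: 4
  assumes "distinct [i, j, k, l]"
  obtains p where "p permutes UNIV" "p 1 = i" "p 2 = j" "p 3 = k" "p 4 = l"
proof
  define p where "p = (\<lambda>n::4. if n = 1 then i else if n = 2 then j else if n = 3 then k else l)"
  show v: "p 1 = i" "p 2 = j" "p 3 = k" "p 4 = l"
    by (simp_all add: p_def)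
  have "\<forall>m n. p m = p n \<longrightarrow> m = n"
    unfolding forall_4 v using assms by auto
  then have "inj p" by (simp add: inj_def)
  then show "p permutes UNIV"
    by (intro bij_imp_permutes) (simp_all add: bij_def finite_UNIV_inj_surj)
qed

section \<open>Tensors with fewer than three eigenvalues\<close>

lemma not_CKT_two_eigenvalues:
  assumes "\<And>x. x \<in> sphere 0 1 \<Longrightarrow> \<exists>r s. \<forall>l v. eigenpair K x l v \<longrightarrow> l = r \<or> l = s"
  shows "\<not> CKT K"
proof
  assume "CKT K"
  then have "sphere 0 1 \<subseteq> closure {x \<in> sphere 0 1. simple_at K x}"
    by (simp add: CKT_def)
  \<comment> \<open>A point of the sphere, so that a set dense in the sphere cannot be
    empty.\<close>
  moreover have "axis 1 1 \<in> sphere (0::real^4) 1"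
    by simp
  ultimately obtain x where x: "x \<in> sphere 0 1" "simple_at K x"
    by (metis (mono_tags, lifting) closure_empty empty_iff ex_in_conv mem_Collect_eq subset_iff)
  obtain r s where "\<forall>l v. eigenpair K x l v \<longrightarrow> l = r \<or> l = s"
    using assms x(1) by blast
  then have "{l. \<exists>v. eigenpair K x l v} \<subseteq> {r, s}" by blast
  then have "card {l. \<exists>v. eigenpair K x l v} \<le> card {r, s}"
    by (intro card_mono) auto
  also have "\<dots> \<le> 2" by (simp add: card_insert_if)
  finally show False using x(2) by (simp add: simple_at_def)
qed

text \<open>After subtracting \<open>b\<close> times the Casimir tensor, a multiple of
  \<open>Rsq 1 2\<close> remains. It has rank at most one, so its only possible nonzero eigenvalue
  is that multiple of the squared length of \<open>R 1 2\<close>.\<close>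

lemma not_CKT_R12:
  assumes c: "symm c" and eq: "c 1 3 = b" "c 1 4 = b" "c 2 3 = b" "c 2 4 = b" "c 3 4 = b"
  shows "\<not> CKT (diag_ten c)"
proof
  assume "CKT (diag_ten c)"
  from CKT_shift[OF this, of "-b"] have CKT: "CKT (diag_ten (\<lambda>i j. c i j - b))"
    unfolding diag_ten_shift by simp
  have c': "symm (\<lambda>i j. c i j - b)" using c by simp
  have e: "c 3 1 = b" "c 4 1 = b" "c 3 2 = b" "c 4 2 = b" "c 4 3 = b" "c 2 1 = c 1 2"
    using c eq by metis+
  define a where "a = c 1 2 - b"
  have "l = 0 \<or> l = a * ((x $ 1)\<^sup>2 + (x $ 2)\<^sup>2)"
    if ev: "eigenpair (diag_ten (\<lambda>i j. c i j - b)) x l v" for x l v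
  proof (cases "l = 0")
    case False
    \<comment> \<open>The inner product of \<open>v\<close> with the field \<open>R 1 2\<close> at
      \<open>x\<close>. Pairing the eigenvalue equation with that field gives the equation for
      \<open>l * q\<close> below.\<close>
    define q where "q = x $ 2 * v $ 1 - x $ 1 * v $ 2"
    have "(diag_ten (\<lambda>i j. c i j - b) x *v v) $ i = l * v $ i" for i
      using ev by (simp add: eigenpair_def)
    from this[of 1] this[of 2] this[of 3] this[of 4]
    have v: "a * x $ 2 * q = l * v $ 1" "- a * x $ 1 * q = l * v $ 2" "v $ 3 = 0" "v $ 4 = 0"
      using False
      by (simp_all add: matrix_vector_mult_def diag_ten_nth[OF c'] sum_4 eq e flip: a_def)
        (simp_all add: q_def power2_eq_square algebra_simps)
    have "l * q = a * ((x $ 1)\<^sup>2 + (x $ 2)\<^sup>2) * q"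
      using v(1,2) unfolding q_def by algebra
    moreover have "q \<noteq> 0"
    proof
      assume "q = 0"
      with v False have "v = 0" by (simp add: vec_eq_iff forall_4)
      with ev show False by (simp add: eigenpair_def)
    qed
    ultimately show ?thesis by simp
  qed simp
  with CKT show False using not_CKT_two_eigenvalues by blast
qed

text \<open>The shifted tensor is a multiple of the Casimir tensor of the first three coordinates.
  An eigenvector with nonzero eigenvalue has \<open>v $ 4 = 0\<close>, hence is orthogonal to the
  projection of \<open>x\<close> to these coordinates, where the tensor acts as a scalar.\<close>

lemma not_CKT_R123:
  assumes c: "symm c" and eq: "c 1 2 = a" "c 1 3 = a" "c 2 3 = a" "c 1 4 = b" "c 2 4 = b" "c 3 4 = b"
  shows "\<not> CKT (diag_ten c)"
proof
  assume "CKT (diag_ten c)"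
  from CKT_shift[OF this, of "-b"] have CKT: "CKT (diag_ten (\<lambda>i j. c i j - b))"
    unfolding diag_ten_shift by simp
  have c': "symm (\<lambda>i j. c i j - b)" using c by simp
  have e: "c 2 1 = a" "c 3 1 = a" "c 3 2 = a" "c 4 1 = b" "c 4 2 = b" "c 4 3 = b"
    using c eq by metis+
  have "l = 0 \<or> l = (a - b) * ((x $ 1)\<^sup>2 + (x $ 2)\<^sup>2 + (x $ 3)\<^sup>2)"
    if ev: "eigenpair (diag_ten (\<lambda>i j. c i j - b)) x l v" for x l v
  proof (cases "l = 0")
    case False
    let ?r = "(a - b) * ((x $ 1)\<^sup>2 + (x $ 2)\<^sup>2 + (x $ 3)\<^sup>2)"
    have o: "x $ 1 * v $ 1 + x $ 2 * v $ 2 + x $ 3 * v $ 3 + x $ 4 * v $ 4 = 0"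
      using ev by (simp add: eigenpair_def inner_vec_def sum_4)
    have "(diag_ten (\<lambda>i j. c i j - b) x *v v) $ i = l * v $ i" for i
      using ev by (simp add: eigenpair_def)
    from this[of 1] this[of 2] this[of 3] this[of 4]
    have v: "(a - b) * (((x $ 2)\<^sup>2 + (x $ 3)\<^sup>2) * v $ 1 - x $ 1 * (x $ 2 * v $ 2 + x $ 3 * v $ 3)) = l * v $ 1"
      "(a - b) * (((x $ 1)\<^sup>2 + (x $ 3)\<^sup>2) * v $ 2 - x $ 2 * (x $ 1 * v $ 1 + x $ 3 * v $ 3)) = l * v $ 2"
      "(a - b) * (((x $ 1)\<^sup>2 + (x $ 2)\<^sup>2) * v $ 3 - x $ 3 * (x $ 1 * v $ 1 + x $ 2 * v $ 2)) = l * v $ 3"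
      "v $ 4 = 0"
      using False
      by (simp_all add: matrix_vector_mult_def diag_ten_nth[OF c'] sum_4 eq e)
        (simp_all add: power2_eq_square algebra_simps)
    have *: "x $ 1 * v $ 1 + x $ 2 * v $ 2 + x $ 3 * v $ 3 = 0"
      using o v(4) by simp
    have "?r * v $ 1 = l * v $ 1" "?r * v $ 2 = l * v $ 2" "?r * v $ 3 = l * v $ 3"
      using v(1-3) * by algebra+
    moreover have "v $ 1 \<noteq> 0 \<or> v $ 2 \<noteq> 0 \<or> v $ 3 \<noteq> 0"
      using ev v(4) by (auto simp: eigenpair_def vec_eq_iff forall_4)
    ultimately show ?thesis by auto
  qed simp
  with CKT show False using not_CKT_two_eigenvalues by blast
qed

section \<open>Coefficient patterns of the canonical forms\<close>

lemma coefficients_exist: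
  obtains c :: "4 \<Rightarrow> 4 \<Rightarrow> real" where "symm c" "c 1 2 = c12" "c 1 3 = c13" "c 1 4 = c14"
    "c 2 3 = c23" "c 2 4 = c24" "c 3 4 = c34"
proof
  \<comment> \<open>Testing unordered pairs makes \<open>c\<close> symmetric by
    construction.\<close>
  define c :: "4 \<Rightarrow> 4 \<Rightarrow> real" where "c = (\<lambda>i j. if {i, j} = {1, 2} then c12 else
    if {i, j} = {1, 3} then c13 else if {i, j} = {1, 4} then c14 else
    if {i, j} = {2, 3} then c23 else if {i, j} = {2, 4} then c24 else c34)"
  show "symm c" by (simp add: c_def insert_commute)
  show "c 1 2 = c12" "c 1 3 = c13" "c 1 4 = c14" "c 2 3 = c23" "c 2 4 = c24" "c 3 4 = c34"
    by (simp_all add: c_def doubleton_eq_iff)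
qed

lemma spherical_form_iff: "spherical_form K \<longleftrightarrow>
    (\<exists>c. symm c \<and> K = diag_ten c \<and> c 1 3 = c 2 3 \<and> c 1 4 = 0 \<and> c 2 4 = 0 \<and> c 3 4 = 0)"
  (is "_ = ?R")
proof
  assume "spherical_form K"
  then obtain c1 c2 where K: "K = c1 *\<^sub>R Rsq 1 2 + c2 *\<^sub>R (Rsq 1 3 + Rsq 2 3)"
    unfolding spherical_form_def by blast
  obtain c where "symm c" "c 1 2 = c1" "c 1 3 = c2" "c 1 4 = 0" "c 2 3 = c2" "c 2 4 = 0" "c 3 4 = 0"
    by (rule coefficients_exist)
  then show ?R by (intro exI[of _ c]) (simp add: K diag_ten_def scaleR_add_right ac_simps)
next
  assume ?R
  then obtain c where c: "K = diag_ten c" "c 2 3 = c 1 3" "c 1 4 = 0" "c 2 4 = 0" "c 3 4 = 0" by auto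
  then show "spherical_form K"
    unfolding spherical_form_def
    by (intro exI[of _ "c 1 2"] exI[of _ "c 1 3"]) (simp add: diag_ten_def scaleR_add_right ac_simps)
qed

lemma cylindrical_form_iff: "cylindrical_form K \<longleftrightarrow>
    (\<exists>c. symm c \<and> K = diag_ten c \<and> c 1 3 = c 1 4 \<and> c 1 3 = c 2 3 \<and> c 1 3 = c 2 4)"
  (is "_ = ?R")
proof
  assume "cylindrical_form K"
  then obtain c1 c2 c3 where K: "K = c1 *\<^sub>R Rsq 1 2 + c2 *\<^sub>R (Rsq 1 3 + Rsq 1 4 + Rsq 2 3 + Rsq 2 4) + c3 *\<^sub>R Rsq 3 4"
    unfolding cylindrical_form_def by blast
  obtain c where "symm c" "c 1 2 = c1" "c 1 3 = c2" "c 1 4 = c2" "c 2 3 = c2" "c 2 4 = c2" "c 3 4 = c3"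
    by (rule coefficients_exist)
  then show ?R by (intro exI[of _ c]) (simp add: K diag_ten_def scaleR_add_right ac_simps)
next
  assume ?R
  then obtain c where c: "K = diag_ten c" "c 1 4 = c 1 3" "c 2 3 = c 1 3" "c 2 4 = c 1 3" by auto
  then show "cylindrical_form K"
    unfolding cylindrical_form_def
    by (intro exI[of _ "c 1 2"] exI[of _ "c 1 3"] exI[of _ "c 3 4"]) (simp add: diag_ten_def scaleR_add_right ac_simps)
qed

lemma spheroelliptic_form_iff: "spheroelliptic_form K \<longleftrightarrow>
    (\<exists>c. symm c \<and> K = diag_ten c \<and> c 1 4 = 0 \<and> c 2 4 = 0 \<and> c 3 4 = 0)"
  (is "_ = ?R")
proof
  assume "spheroelliptic_form K"
  then obtain c1 c2 c3 where K: "K = c1 *\<^sub>R Rsq 1 2 + c2 *\<^sub>R Rsq 1 3 + c3 *\<^sub>R Rsq 2 3"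
    unfolding spheroelliptic_form_def by blast
  obtain c where "symm c" "c 1 2 = c1" "c 1 3 = c2" "c 1 4 = 0" "c 2 3 = c3" "c 2 4 = 0" "c 3 4 = 0"
    by (rule coefficients_exist)
  then show ?R by (intro exI[of _ c]) (simp add: K diag_ten_def)
next
  assume ?R
  then obtain c where c: "K = diag_ten c" "c 1 4 = 0" "c 2 4 = 0" "c 3 4 = 0" by auto
  then show "spheroelliptic_form K"
    unfolding spheroelliptic_form_def
    by (intro exI[of _ "c 1 2"] exI[of _ "c 1 3"] exI[of _ "c 2 3"]) (simp add: diag_ten_def)
qed

lemma elliptic_cylindrical_diag_ten:
  obtains c where "symm c" "elliptic_cylindrical c1 c2 c3 c4 = diag_ten c"
    "c 1 2 = c1" "c 1 3 = c2" "c 2 3 = c2" "c 1 4 = c3" "c 2 4 = c3" "c 3 4 = c4"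
proof -
  obtain c where "symm c" "c 1 2 = c1" "c 1 3 = c2" "c 1 4 = c3" "c 2 3 = c2" "c 2 4 = c3" "c 3 4 = c4"
    by (rule coefficients_exist)
  moreover from this have "elliptic_cylindrical c1 c2 c3 c4 = diag_ten c"
    by (simp add: elliptic_cylindrical_def diag_ten_def scaleR_add_right ac_simps)
  ultimately show thesis using that by blast
qed

lemma ellipsoidal_form_diag_ten:
  assumes "ellipsoidal_form K"
  obtains c where "symm c" "K = diag_ten c"
proof -
  obtain c1 c2 c3 c4 c5 c6 where K: "K = c1 *\<^sub>R Rsq 1 2 + c2 *\<^sub>R Rsq 1 3 + c3 *\<^sub>R Rsq 1 4
       + c4 *\<^sub>R Rsq 2 3 + c5 *\<^sub>R Rsq 2 4 + c6 *\<^sub>R Rsq 3 4"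
    using assms unfolding ellipsoidal_form_def by blast
  obtain c where "symm c" "c 1 2 = c1" "c 1 3 = c2" "c 1 4 = c3" "c 2 3 = c4" "c 2 4 = c5" "c 3 4 = c6"
    by (rule coefficients_exist)
  then show thesis using that[of c] by (simp add: K diag_ten_def)
qed

text \<open>Moves a coincidence among coefficients at arbitrary indices to standard position inside
  the orbit, so that each pattern has to be treated only once.\<close>

lemma reorder:
  assumes c: "symm c" and K: "CKT (diag_ten c)" and d: "distinct [i, j, k, l]"
  obtains c' where "symm c'" "CKT (diag_ten c')" "equivalent (diag_ten c') (diag_ten c)"
    "c' 1 2 = c i j" "c' 1 3 = c i k" "c' 1 4 = c i l" "c' 2 3 = c j k" "c' 2 4 = c j l" "c' 3 4 = c k l"
proof -
  obtain p where p: "p permutes UNIV" "p 1 = i" "p 2 = j" "p 3 = k" "p 4 = l"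
    using permutation_of_distinct[OF d] .
  have "equivalent (diag_ten c) (diag_ten (\<lambda>i j. c (p i) (p j)))"
    using diag_ten_permute[OF p(1) c] .
  with K have "CKT (diag_ten (\<lambda>i j. c (p i) (p j)))"
    and "equivalent (diag_ten (\<lambda>i j. c (p i) (p j))) (diag_ten c)"
    by (blast intro: equivalent_CKT equivalent_sym)+
  then show thesis
    using that[of "\<lambda>i j. c (p i) (p j)"] c p by simp
qed

lemma CKT_not_all_but_one_equal:
  assumes "symm c" "CKT (diag_ten c)" "distinct [i, j, k, l]"
  shows "\<not> (c i k = c i l \<and> c i k = c j k \<and> c i k = c j l \<and> c i k = c k l)"
  using reorder[OF assms] not_CKT_R12 by metis

text \<open>This pattern is invariant under all rotations fixing the axis \<open>l\<close>, too much
  symmetry for three distinct eigenvalues.\<close>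

lemma CKT_not_point_symmetric:
  assumes "symm c" "CKT (diag_ten c)" "distinct [i, j, k, l]"
  shows "\<not> (c i j = c i k \<and> c i j = c j k \<and> c i l = c j l \<and> c i l = c k l)"
  using reorder[OF assms] not_CKT_R123 by metis

section \<open>Coefficient patterns that force a more symmetric web\<close>

definition spherical_orbit :: "tfield \<Rightarrow> bool" where
  "spherical_orbit K \<longleftrightarrow> (\<exists>K'. spherical_CKT K' \<and> equivalent K' K)"

definition cylindrical_orbit :: "tfield \<Rightarrow> bool" where
  "cylindrical_orbit K \<longleftrightarrow> (\<exists>K'. cylindrical_CKT K' \<and> equivalent K' K)"

lemma spherical_orbitI:
  assumes "symm c" "CKT (diag_ten c)" "distinct [i, j, k, l]"
    and "c i k = c j k" "c i l = c j l" "c i l = c k l"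
  shows "spherical_orbit (diag_ten c)"
proof -
  obtain c' where c': "symm c'" "CKT (diag_ten c')" "equivalent (diag_ten c') (diag_ten c)"
    and eq: "c' 1 3 = c' 2 3" "c' 1 4 = c' 2 4" "c' 1 4 = c' 3 4"
    using reorder[OF assms(1-3)] assms(4-6) by metis
  \<comment> \<open>The canonical form has zero coefficients at index 4; subtracting their common
    value achieves this.\<close>
  let ?K = "diag_ten c' + (- c' 1 4) *\<^sub>R casimir"
  have "spherical_form ?K"
    unfolding spherical_form_iff diag_ten_shift using c'(1) eq
    by (intro exI[of _ "\<lambda>i j. c' i j + - c' 1 4"]) simp
  moreover have "CKT ?K" using CKT_shift[OF c'(2)] .
  moreover have "equivalent ?K (diag_ten c)"
    using equivalent_trans[OF equivalent_sym[OF equivalent_shift] c'(3)] .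
  ultimately show ?thesis unfolding spherical_orbit_def spherical_CKT_def by blast
qed

lemma cylindrical_orbitI:
  assumes "symm c" "CKT (diag_ten c)" "distinct [i, j, k, l]"
    and "c i k = c i l" "c i k = c j k" "c i k = c j l"
  shows "cylindrical_orbit (diag_ten c)"
proof -
  obtain c' where c': "symm c'" "CKT (diag_ten c')" "equivalent (diag_ten c') (diag_ten c)"
    and eq: "c' 1 3 = c' 1 4" "c' 1 3 = c' 2 3" "c' 1 3 = c' 2 4"
    using reorder[OF assms(1-3)] assms(4-6) by metis
  have "cylindrical_form (diag_ten c')"
    unfolding cylindrical_form_iff using c'(1) eq by blast
  then show ?thesis unfolding cylindrical_orbit_def cylindrical_CKT_def using c' by blast
qed

text \<open>The condition excluded in \<open>ellipsoidal_CKT\<close>.\<close>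

definition simpler_orbit :: "tfield \<Rightarrow> bool" where
  "simpler_orbit K \<longleftrightarrow> (\<exists>K'. (spherical_CKT K' \<or> cylindrical_CKT K' \<or> spheroelliptic_CKT K' \<or>
     (\<exists>k2. elliptic_cylindrical1_CKT k2 K' \<or> elliptic_cylindrical2_CKT k2 K')) \<and> equivalent K' K)"

lemma simpler_orbitI_sph_cyl:
  "spherical_orbit K \<or> cylindrical_orbit K \<Longrightarrow> simpler_orbit K"
  unfolding spherical_orbit_def cylindrical_orbit_def simpler_orbit_def by blast

lemma simpler_orbit_equivalent: "simpler_orbit K \<Longrightarrow> equivalent K L \<Longrightarrow> simpler_orbit L"
  unfolding simpler_orbit_def using equivalent_trans by blast

text \<open>The pattern forced by a translational symmetry along axis \<open>l\<close>. After a
  shift the tensor has spheroelliptic form; if it is degenerate, it lies in a spherical orbit, which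
  is simpler as well.\<close>

lemma simpler_orbitI_spheroelliptic:
  assumes "symm c" "CKT (diag_ten c)" "distinct [i, j, k, l]"
    and "c i l = c j l" "c i l = c k l"
  shows "simpler_orbit (diag_ten c)"
proof -
  obtain c' where c': "symm c'" "CKT (diag_ten c')" "equivalent (diag_ten c') (diag_ten c)"
    and eq: "c' 1 4 = c' 2 4" "c' 1 4 = c' 3 4"
    using reorder[OF assms(1-3)] assms(4-5) by metis
  let ?K = "diag_ten c' + (- c' 1 4) *\<^sub>R casimir"
  have form: "spheroelliptic_form ?K"
    unfolding spheroelliptic_form_iff diag_ten_shift using c'(1) eq
    by (intro exI[of _ "\<lambda>i j. c' i j + - c' 1 4"]) simp
  have K: "CKT ?K" using CKT_shift[OF c'(2)] .
  have "simpler_orbit ?K"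
  proof (cases "\<exists>K'. spherical_CKT K' \<and> equivalent K' ?K")
    case False
    then have "spheroelliptic_CKT ?K"
      unfolding spheroelliptic_CKT_def using K form by blast
    then show ?thesis
      unfolding simpler_orbit_def using equivalent_refl by blast
  qed (unfold simpler_orbit_def, blast)
  then show ?thesis
    using simpler_orbit_equivalent equivalent_trans[OF equivalent_sym[OF equivalent_shift] c'(3)] by blast
qed

text \<open>The pattern forced by a rotational symmetry in the plane of \<open>i\<close> and
  \<open>j\<close>.\<close>

lemma simpler_orbitI_elliptic_cylindrical:
  assumes "symm c" "CKT (diag_ten c)" "distinct [i, j, k, l]"
    and "c i k = c j k" "c i l = c j l"
  shows "simpler_orbit (diag_ten c)"
proof -
  obtain c' where c': "symm c'" "CKT (diag_ten c')" "equivalent (diag_ten c') (diag_ten c)"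
    and eq: "c' 1 3 = c' 2 3" "c' 1 4 = c' 2 4"
    using reorder[OF assms(1-3)] assms(4-5) by metis
  have "simpler_orbit (diag_ten c')"
  \<comment> \<open>The parameter of type 1 has denominator \<open>c' 3 4 - c' 1 4\<close>. If this
    is zero, all coefficients at index 4 agree and the tensor is spherical; otherwise type 1 can be
    used.\<close>
  proof (cases "c' 3 4 = c' 1 4 \<or> spherical_orbit (diag_ten c') \<or> cylindrical_orbit (diag_ten c')")
    case True
    then show ?thesis
      using spherical_orbitI[OF c'(1,2), of 1 2 3 4] eq simpler_orbitI_sph_cyl by auto
  next
    case False
    have "diag_ten c' = elliptic_cylindrical (c' 1 2) (c' 1 3) (c' 1 4) (c' 3 4)"
      by (simp add: diag_ten_def elliptic_cylindrical_def eq scaleR_add_right ac_simps)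
    with False have "elliptic_cylindrical1_form ((c' 3 4 - c' 1 3) / (c' 3 4 - c' 1 4)) (diag_ten c')"
      unfolding elliptic_cylindrical1_form_def by blast
    with False have "elliptic_cylindrical1_CKT ((c' 3 4 - c' 1 3) / (c' 3 4 - c' 1 4)) (diag_ten c')"
      unfolding elliptic_cylindrical1_CKT_def spherical_orbit_def cylindrical_orbit_def
      using c'(2) by blast
    then show ?thesis unfolding simpler_orbit_def using equivalent_refl by blast
  qed
  then show ?thesis using simpler_orbit_equivalent c'(3) by blast
qed

section \<open>The symmetries of the canonical forms\<close>

lemma Sym_translation_part:
  assumes "symm c" "skew B" "affine_field A B \<in> Sym (diag_ten c)" "A $ l \<noteq> 0" "distinct [i, j, k, l]"
  shows "c i l = c j l" "c i l = c k l"
proof -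
  obtain \<alpha> where "\<forall>i k. i \<noteq> k \<longrightarrow> (c i k + \<alpha>) * A $ k = 0"
    using assms Sym_diag_iff by blast
  then have "c n l = - \<alpha>" if "n \<noteq> l" for n
    using that assms(4) by (metis add_eq_0_iff2 mult_eq_0_iff)
  then show "c i l = c j l" "c i l = c k l" using assms(5) by auto
qed

lemma Sym_rotation_part:
  assumes "symm c" "skew B" "affine_field A B \<in> Sym (diag_ten c)" "B $ k $ m \<noteq> 0" "i \<noteq> k" "i \<noteq> m"
  shows "c k i = c m i"
proof -
  have "k \<noteq> m" using assms(2,4) by auto
  then have "B $ k $ m * (c i k - c i m) = 0"
    using assms Sym_diag_iff by blast
  then show ?thesis using assms(1,4) by auto
qed

lemma span_pair: "x \<in> span {a, b} \<longleftrightarrow> (\<exists>s t. x = s *\<^sub>R a + t *\<^sub>R b)"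
  by (auto simp: span_insert span_singleton) (metis add.commute diff_add_cancel add_diff_cancel_left')+

lemma Sym_cylindrical:
  assumes "cylindrical_CKT K"
  shows "Sym K = span {R 1 2, R 3 4}"
proof -
  obtain c where c: "symm c" "K = diag_ten c" "c 1 3 = c 1 4" "c 1 3 = c 2 3" "c 1 3 = c 2 4"
    using assms unfolding cylindrical_CKT_def cylindrical_form_iff by blast
  have K: "CKT (diag_ten c)" using assms c(2) by (simp add: cylindrical_CKT_def)
  note s = c(1)[rule_format]
  \<comment> \<open>Either equality would leave a single exceptional coefficient,
    \<open>c 3 4\<close> or \<open>c 1 2\<close>, and thus at most two eigenvalues.\<close>
  have n: "\<not> (c 1 3 = c 1 2)" "\<not> (c 1 3 = c 3 4)"
    using CKT_not_all_but_one_equal[OF c(1) K, of 1 2 3 4] CKT_not_all_but_one_equal[OF c(1) K, of 3 4 1 2]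
      s[of 3 1] s[of 3 2] s[of 4 1] s[of 4 2] c(3-5) by auto
  show ?thesis
  proof (intro subset_antisym subsetI)
    fix V assume "V \<in> Sym K"
    then obtain A B where V: "V = affine_field A B" and B: "skew B" and AB: "affine_field A B \<in> Sym (diag_ten c)"
      unfolding c(2) by (auto simp: Sym_def killing_vectors_eq)
    note t = Sym_translation_part[OF c(1) B AB] and r = Sym_rotation_part[OF c(1) B AB]
    have "A $ 1 = 0" using t[of 1 2 3 4] s[of 2 1] s[of 3 1] n c by (cases "A $ 1 = 0") auto
    moreover have "A $ 2 = 0" using t[of 2 1 3 4] s[of 3 2] n c by (cases "A $ 2 = 0") auto
    moreover have "A $ 3 = 0" using t[of 3 1 2 4] s[of 4 3] n c by (cases "A $ 3 = 0") auto
    moreover have "A $ 4 = 0" using t[of 4 1 2 3] n c by (cases "A $ 4 = 0") auto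
    moreover have "B $ 1 $ 3 = 0" using r[of 1 3 2] s[of 3 2] n c by (cases "B $ 1 $ 3 = 0") auto
    moreover have "B $ 1 $ 4 = 0" using r[of 1 4 2] s[of 4 2] n c by (cases "B $ 1 $ 4 = 0") auto
    moreover have "B $ 2 $ 3 = 0" using r[of 2 3 1] s[of 2 1] s[of 3 1] n c by (cases "B $ 2 $ 3 = 0") auto
    moreover have "B $ 2 $ 4 = 0" using r[of 2 4 1] s[of 2 1] s[of 4 1] n c by (cases "B $ 2 $ 4 = 0") auto
    ultimately show "V \<in> span {R 1 2, R 3 4}"
      unfolding V affine_field_decomp[OF B] span_pair by auto
  next
    fix V assume "V \<in> span {R 1 2, R 3 4}"
    then obtain a b where "V = a *\<^sub>R R 1 2 + b *\<^sub>R R 3 4" unfolding span_pair by blast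
    then have V: "V = affine_field 0 (a *\<^sub>R elementary_skew 1 2 + b *\<^sub>R elementary_skew 3 4)"
      by (simp add: R_affine affine_field_add affine_field_scaleR)
    have B: "skew (a *\<^sub>R elementary_skew 1 2 + b *\<^sub>R elementary_skew 3 4)"
      by (intro skew_add skew_scaleR skew_elementary)
    show "V \<in> Sym K"
      unfolding V c(2) Sym_diag_iff[OF c(1) B] using s[of 3 1] s[of 3 2] s[of 4 1] s[of 4 2] c(3-5)
      by (auto simp: forall_4 axis_def elementary_skew_def)
  qed
qed

lemma Sym_spherical:
  assumes "spherical_CKT K"
  shows "Sym K = span {R 1 2, X 4}"
proof -
  obtain c where c: "symm c" "K = diag_ten c" "c 1 3 = c 2 3" "c 1 4 = 0" "c 2 4 = 0" "c 3 4 = 0"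
    using assms unfolding spherical_CKT_def spherical_form_iff by blast
  have K: "CKT (diag_ten c)" using assms c(2) by (simp add: spherical_CKT_def)
  note s = c(1)[rule_format, of 2 1] c(1)[rule_format, of 3 1] c(1)[rule_format, of 4 1]
    c(1)[rule_format, of 3 2] c(1)[rule_format, of 4 2] c(1)[rule_format, of 4 3]
  \<comment> \<open>If \<open>c 1 3\<close> were 0, only \<open>Rsq 1 2\<close> could remain; if it
    equalled \<open>c 1 2\<close>, the tensor would be symmetric under all rotations about axis
    4.\<close>
  have n: "c 1 3 \<noteq> 0" "c 1 3 \<noteq> c 1 2"
    using CKT_not_all_but_one_equal[OF c(1) K, of 1 2 3 4] CKT_not_point_symmetric[OF c(1) K, of 1 2 3 4] c by auto
  show ?thesis
  proof (intro subset_antisym subsetI)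
    fix V assume "V \<in> Sym K"
    then obtain A B where V: "V = affine_field A B" and B: "skew B" and AB: "affine_field A B \<in> Sym (diag_ten c)"
      unfolding c(2) by (auto simp: Sym_def killing_vectors_eq)
    note t = Sym_translation_part[OF c(1) B AB] and r = Sym_rotation_part[OF c(1) B AB]
    have "A $ 1 = 0" using t[of 1 3 2 4] s n c(3-6) by (cases "A $ 1 = 0") auto
    moreover have "A $ 2 = 0" using t[of 2 3 1 4] s n c(3-6) by (cases "A $ 2 = 0") auto
    moreover have "A $ 3 = 0" using t[of 3 1 2 4] s n c(3-6) by (cases "A $ 3 = 0") auto
    moreover have "B $ 1 $ 3 = 0" using r[of 1 3 2] s n c(3-6) by (cases "B $ 1 $ 3 = 0") auto
    moreover have "B $ 1 $ 4 = 0" using r[of 1 4 3] s n c(3-6) by (cases "B $ 1 $ 4 = 0") auto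
    moreover have "B $ 2 $ 3 = 0" using r[of 2 3 1] s n c(3-6) by (cases "B $ 2 $ 3 = 0") auto
    moreover have "B $ 2 $ 4 = 0" using r[of 2 4 3] s n c(3-6) by (cases "B $ 2 $ 4 = 0") auto
    moreover have "B $ 3 $ 4 = 0" using r[of 3 4 1] s n c(3-6) by (cases "B $ 3 $ 4 = 0") auto
    ultimately show "V \<in> span {R 1 2, X 4}"
      unfolding V affine_field_decomp[OF B] span_pair by (auto intro!: exI add.commute)
  next
    fix V assume "V \<in> span {R 1 2, X 4}"
    then obtain a b where "V = a *\<^sub>R R 1 2 + b *\<^sub>R X 4" unfolding span_pair by blast
    then have V: "V = affine_field (b *\<^sub>R axis 4 1) (a *\<^sub>R elementary_skew 1 2)"
      by (simp add: R_affine X_affine affine_field_add affine_field_scaleR)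
    have B: "skew (a *\<^sub>R elementary_skew 1 2)"
      by (intro skew_add skew_scaleR skew_elementary)
    show "V \<in> Sym K"
      unfolding V c(2) Sym_diag_iff[OF c(1) B] using s c(3-6)
      by (auto simp: forall_4 axis_def elementary_skew_def intro!: exI[of _ 0])
  qed
qed

lemma Sym_spheroelliptic:
  assumes "spheroelliptic_CKT K"
  shows "Sym K = span {X 4}"
proof -
  obtain c where c: "symm c" "K = diag_ten c" "c 1 4 = 0" "c 2 4 = 0" "c 3 4 = 0"
    using assms unfolding spheroelliptic_CKT_def spheroelliptic_form_iff by blast
  have K: "CKT (diag_ten c)" using assms c(2) by (simp add: spheroelliptic_CKT_def)
  have ns: "\<not> spherical_orbit (diag_ten c)"
    using assms unfolding c(2) spheroelliptic_CKT_def spherical_orbit_def by blast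
  note s = c(1)[rule_format, of 2 1] c(1)[rule_format, of 3 1] c(1)[rule_format, of 4 1]
    c(1)[rule_format, of 3 2] c(1)[rule_format, of 4 2] c(1)[rule_format, of 4 3]
  \<comment> \<open>Any two equal coefficients give a spherical tensor after permuting the first
    three coordinates.\<close>
  have n: "c 1 3 \<noteq> c 2 3" "c 1 2 \<noteq> c 2 3" "c 1 2 \<noteq> c 1 3"
    using ns spherical_orbitI[OF c(1) K, of 1 2 3 4] spherical_orbitI[OF c(1) K, of 1 3 2 4]
      spherical_orbitI[OF c(1) K, of 2 3 1 4] s c(3-5) by auto
  show ?thesis
  proof (intro subset_antisym subsetI)
    fix V assume "V \<in> Sym K"
    then obtain A B where V: "V = affine_field A B" and B: "skew B" and AB: "affine_field A B \<in> Sym (diag_ten c)"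
      unfolding c(2) by (auto simp: Sym_def killing_vectors_eq)
    note t = Sym_translation_part[OF c(1) B AB] and r = Sym_rotation_part[OF c(1) B AB]
    have "A $ 1 = 0" using t[of 1 2 3 4] s n c(3-5) by (cases "A $ 1 = 0") auto
    moreover have "A $ 2 = 0" using t[of 2 1 3 4] s n c(3-5) by (cases "A $ 2 = 0") auto
    moreover have "A $ 3 = 0" using t[of 3 1 2 4] s n c(3-5) by (cases "A $ 3 = 0") auto
    moreover have "B $ 1 $ 2 = 0" using r[of 1 2 3] s n c(3-5) by (cases "B $ 1 $ 2 = 0") auto
    moreover have "B $ 1 $ 3 = 0" using r[of 1 3 2] s n c(3-5) by (cases "B $ 1 $ 3 = 0") auto
    moreover have "B $ 2 $ 3 = 0" using r[of 2 3 1] s n c(3-5) by (cases "B $ 2 $ 3 = 0") auto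
    \<comment> \<open>A rotation involving axis 4 would make two of the three distinct coefficients
      equal to 0.\<close>
    moreover have "B $ 1 $ 4 = 0" using r[of 1 4 2] r[of 1 4 3] s n c(3-5) by (cases "B $ 1 $ 4 = 0") auto
    moreover have "B $ 2 $ 4 = 0" using r[of 2 4 1] r[of 2 4 3] s n c(3-5) by (cases "B $ 2 $ 4 = 0") auto
    moreover have "B $ 3 $ 4 = 0" using r[of 3 4 1] r[of 3 4 2] s n c(3-5) by (cases "B $ 3 $ 4 = 0") auto
    ultimately show "V \<in> span {X 4}"
      unfolding V affine_field_decomp[OF B] span_singleton by auto
  next
    fix V assume "V \<in> span {X 4}"
    then obtain b where "V = b *\<^sub>R X 4" unfolding span_singleton by blast
    then have V: "V = affine_field (b *\<^sub>R axis 4 1) 0"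
      by (simp add: X_affine affine_field_scaleR)
    show "V \<in> Sym K"
      unfolding V c(2)
      by (subst Sym_diag_iff[OF c(1) skew_0])
        (use c(3-5) in \<open>auto simp: forall_4 axis_def intro!: exI[of _ 0]\<close>)
  qed
qed

lemma Sym_elliptic_cylindrical:
  assumes K: "CKT K" "K = elliptic_cylindrical c1 c2 c3 c4"
    and no: "\<not> (\<exists>K'. (spherical_CKT K' \<or> cylindrical_CKT K') \<and> equivalent K' K)"
  shows "Sym K = span {R 1 2}"
proof -
  obtain c where c: "symm c" "K = diag_ten c" "c 1 3 = c 2 3" "c 1 4 = c 2 4"
    using elliptic_cylindrical_diag_ten[of c1 c2 c3 c4] K(2) by metis
  have K: "CKT (diag_ten c)" using K(1) c(2) by simp
  have ns: "\<not> spherical_orbit (diag_ten c)" and nc: "\<not> cylindrical_orbit (diag_ten c)"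
    using no unfolding c(2) cylindrical_orbit_def spherical_orbit_def by blast+
  note s = c(1)[rule_format, of 2 1] c(1)[rule_format, of 3 1] c(1)[rule_format, of 4 1]
    c(1)[rule_format, of 3 2] c(1)[rule_format, of 4 2] c(1)[rule_format, of 4 3]
  \<comment> \<open>The first equality would make the tensor cylindrical, the others spherical with
    axis 4 or axis 3 as the distinguished axis.\<close>
  have n: "c 1 3 \<noteq> c 1 4" "c 1 4 \<noteq> c 3 4" "c 1 3 \<noteq> c 3 4"
    using ns nc cylindrical_orbitI[OF c(1) K, of 1 2 3 4] spherical_orbitI[OF c(1) K, of 1 2 3 4]
      spherical_orbitI[OF c(1) K, of 1 2 4 3] s c(3,4) by auto
  show ?thesis
  proof (intro subset_antisym subsetI)
    fix V assume "V \<in> Sym K"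
    then obtain A B where V: "V = affine_field A B" and B: "skew B" and AB: "affine_field A B \<in> Sym (diag_ten c)"
      unfolding c(2) by (auto simp: Sym_def killing_vectors_eq)
    note t = Sym_translation_part[OF c(1) B AB] and r = Sym_rotation_part[OF c(1) B AB]
    have "A $ 1 = 0" using t[of 1 2 3 4] s n c(3,4) by (cases "A $ 1 = 0") auto
    moreover have "A $ 2 = 0" using t[of 2 1 3 4] s n c(3,4) by (cases "A $ 2 = 0") auto
    moreover have "A $ 3 = 0" using t[of 3 1 2 4] s n c(3,4) by (cases "A $ 3 = 0") auto
    moreover have "A $ 4 = 0" using t[of 4 1 2 3] s n c(3,4) by (cases "A $ 4 = 0") auto
    moreover have "B $ 1 $ 3 = 0" using r[of 1 3 4] s n c(3,4) by (cases "B $ 1 $ 3 = 0") auto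
    moreover have "B $ 1 $ 4 = 0" using r[of 1 4 3] s n c(3,4) by (cases "B $ 1 $ 4 = 0") auto
    moreover have "B $ 2 $ 3 = 0" using r[of 2 3 4] s n c(3,4) by (cases "B $ 2 $ 3 = 0") auto
    moreover have "B $ 2 $ 4 = 0" using r[of 2 4 3] s n c(3,4) by (cases "B $ 2 $ 4 = 0") auto
    moreover have "B $ 3 $ 4 = 0" using r[of 3 4 1] s n c(3,4) by (cases "B $ 3 $ 4 = 0") auto
    ultimately show "V \<in> span {R 1 2}"
      unfolding V affine_field_decomp[OF B] span_singleton by auto
  next
    fix V assume "V \<in> span {R 1 2}"
    then obtain b where "V = b *\<^sub>R R 1 2" unfolding span_singleton by blast
    then have V: "V = affine_field 0 (b *\<^sub>R elementary_skew 1 2)"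
      by (simp add: R_affine affine_field_scaleR)
    have B: "skew (b *\<^sub>R elementary_skew 1 2)"
      by (intro skew_add skew_scaleR skew_elementary)
    show "V \<in> Sym K"
      unfolding V c(2) Sym_diag_iff[OF c(1) B] using s c(3,4)
      by (auto simp: forall_4 axis_def elementary_skew_def)
  qed
qed

lemma Sym_ellipsoidal:
  assumes "ellipsoidal_CKT K"
  shows "Sym K = {0}"
proof -
  obtain c where c: "symm c" "K = diag_ten c"
    using assms ellipsoidal_form_diag_ten unfolding ellipsoidal_CKT_def by blast
  have K: "CKT (diag_ten c)" using assms c(2) by (simp add: ellipsoidal_CKT_def)
  have no: "\<not> simpler_orbit (diag_ten c)"
    using assms unfolding c(2) ellipsoidal_CKT_def simpler_orbit_def by blast
  show ?thesis
  proof (intro subset_antisym subsetI)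
    fix V assume "V \<in> Sym K"
    then obtain A B where V: "V = affine_field A B" and B: "skew B" and AB: "affine_field A B \<in> Sym (diag_ten c)"
      unfolding c(2) by (auto simp: Sym_def killing_vectors_eq)
    \<comment> \<open>A nonzero \<open>A $ l\<close> would put the tensor into the spheroelliptic
      pattern, a nonzero \<open>B $ i $ j\<close> into the elliptic-cylindrical one, both
      excluded.\<close>
    have t: "A $ l = 0" if "distinct [i, j, k, l]" for i j k l
      using Sym_translation_part[OF c(1) B AB _ that] simpler_orbitI_spheroelliptic[OF c(1) K that] no by blast
    have r: "B $ i $ j = 0" if "distinct [i, j, k, l]" for i j k l
      using Sym_rotation_part[OF c(1) B AB, of i j k] Sym_rotation_part[OF c(1) B AB, of i j l]
        simpler_orbitI_elliptic_cylindrical[OF c(1) K that] no that by auto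
    have "V = 0"
      using t[of 2 3 4 1] t[of 1 3 4 2] t[of 1 2 4 3] t[of 1 2 3 4]
        r[of 1 2 3 4] r[of 1 3 2 4] r[of 1 4 2 3] r[of 2 3 1 4] r[of 2 4 1 3] r[of 3 4 1 2]
      unfolding V affine_field_decomp[OF B] by simp
    then show "V \<in> {0}" by simp
  next
    fix V :: vfield assume "V \<in> {0}"
    then have V: "V = affine_field 0 0" by simp
    show "V \<in> Sym K"
      unfolding V c(2) by (subst Sym_diag_iff[OF c(1) skew_0]) simp
  qed
qed

section \<open>Counting the symmetry generators\<close>

lemma translation_rotation_0: "V \<in> translation_vectors \<Longrightarrow> V \<in> rotation_vectors \<Longrightarrow> V = 0"
  by (auto simp: translation_vectors_eq rotation_vectors_eq)

lemma zero_in_translation_vectors: "0 \<in> translation_vectors"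
  and zero_in_rotation_vectors: "0 \<in> rotation_vectors"
  by (simp_all add: translation_vectors_def rotation_vectors_def span_zero)

lemma X_nonzero: "X i \<noteq> 0"
  using affine_field_eq_iff[of "axis i 1" 0 0 0] by (simp add: X_affine axis_eq_0_iff)

lemma R_nonzero:
  assumes "i \<noteq> j"
  shows "R i j \<noteq> 0"
proof -
  have "elementary_skew i j $ i $ j = 1"
    using assms by (simp add: elementary_skew_def axis_def)
  then have "elementary_skew i j \<noteq> 0" by (metis zero_index zero_neq_one)
  then show ?thesis
    using affine_field_eq_iff[of 0 "elementary_skew i j" 0 0] by (simp add: R_affine)
qed

lemma dim_zero: "dim {0 :: 'a::real_vector} = 0"
  using real_vector.dim_eq_card[of "{}" "{0 :: 'a}"] by (simp add: real_vector.independent_empty)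

lemma dim_span_singleton:
  "x \<noteq> 0 \<Longrightarrow> dim (span {x :: 'a::real_vector}) = 1"
  using real_vector.dim_span_eq_card_independent[of "{x}"] by simp

lemma dim_span_R12_R34: "dim (span {R 1 2, R 3 4}) = 2"
proof -
  have "R 1 2 \<noteq> t *\<^sub>R R 3 4" for t
  proof
    assume "R 1 2 = t *\<^sub>R R 3 4"
    then have "elementary_skew 1 2 $ 1 $ 2 = (t *\<^sub>R elementary_skew 3 4) $ 1 $ 2"
      by (simp add: R_affine affine_field_scaleR)
    then show False by (simp add: elementary_skew_def axis_def)
  qed
  then have n: "R 1 2 \<notin> span {R 3 4}" by (auto simp: span_singleton)
  moreover have "independent {R 3 4}" using R_nonzero[of 3 4] by simp
  ultimately have "independent {R 1 2, R 3 4}"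
    by (rule real_vector.independent_insertI)
  moreover have "R 1 2 \<noteq> R 3 4" using n by (auto intro: span_base)
  ultimately show ?thesis
    by (simp add: real_vector.dim_eq_card_independent)
qed

text \<open>Translations first, rotations second. The five pairs are distinct, so the counts
  determine the category.\<close>

fun generator_counts :: "category \<Rightarrow> nat \<times> nat" where
  "generator_counts Cylindrical = (0, 2)"
| "generator_counts Spherical = (1, 1)"
| "generator_counts Spheroelliptic = (1, 0)"
| "generator_counts Elliptic_Cylindrical = (0, 1)"
| "generator_counts Ellipsoidal = (0, 0)"

lemma generator_counts_inj: "generator_counts w = generator_counts w' \<longleftrightarrow> w = w'"
  by (cases w; cases w') auto

lemma span_rotations: "S \<subseteq> rotation_vectors \<Longrightarrow> span S \<subseteq> rotation_vectors"
  and span_translations: "S \<subseteq> translation_vectors \<Longrightarrow> span S \<subseteq> translation_vectors"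
  unfolding rotation_vectors_def translation_vectors_def by (simp_all add: span_minimal)

lemma R_in: "R i j \<in> rotation_vectors" and X_in: "X i \<in> translation_vectors"
  unfolding rotation_vectors_def translation_vectors_def by (auto intro: span_base)

lemma counts_of_rotations:
  assumes "Sym K = span S" "S \<subseteq> rotation_vectors"
  shows "n_translations K = 0" "n_rotations K = dim (span S)"
proof -
  have "Sym K \<subseteq> rotation_vectors" using span_rotations assms by simp
  moreover have "0 \<in> Sym K" using assms(1) by (simp add: span_zero)
  ultimately have "Sym K \<inter> translation_vectors = {0}"
    using translation_rotation_0 zero_in_translation_vectors by auto
  moreover have "Sym K \<inter> rotation_vectors = span S"
    using span_rotations assms by (simp add: Int_absorb2)
  ultimately show "n_translations K = 0" "n_rotations K = dim (span S)"
    unfolding n_translations_def n_rotations_def by (simp_all only: dim_zero)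
qed

lemma counts_of_translations:
  assumes "Sym K = span S" "S \<subseteq> translation_vectors"
  shows "n_translations K = dim (span S)" "n_rotations K = 0"
proof -
  have "Sym K \<subseteq> translation_vectors" using span_translations assms by simp
  moreover have "0 \<in> Sym K" using assms(1) by (simp add: span_zero)
  ultimately have "Sym K \<inter> rotation_vectors = {0}"
    using translation_rotation_0 zero_in_rotation_vectors by auto
  moreover have "Sym K \<inter> translation_vectors = span S"
    using span_translations assms by (simp add: Int_absorb2)
  ultimately show "n_translations K = dim (span S)" "n_rotations K = 0"
    unfolding n_translations_def n_rotations_def by (simp_all only: dim_zero)
qed

lemma span_R_X_Int_translation: "span {R i j, X k} \<inter> translation_vectors = span {X k}"
proof (intro subset_antisym subsetI)
  fix V assume V: "V \<in> span {R i j, X k} \<inter> translation_vectors"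
  then obtain s t where st: "V = s *\<^sub>R R i j + t *\<^sub>R X k"
    using span_pair[THEN iffD1] by blast
  \<comment> \<open>This difference is both a translation and a multiple of a rotation, hence
    0.\<close>
  have "V - t *\<^sub>R X k \<in> translation_vectors"
    using V[THEN IntD2] X_in[of k] unfolding translation_vectors_def by (intro span_diff span_scale)
  moreover have "V - t *\<^sub>R X k \<in> rotation_vectors"
    using R_in[of i j] unfolding rotation_vectors_def by (simp add: st span_scale)
  ultimately have "V = t *\<^sub>R X k"
    using translation_rotation_0 by fastforce
  then show "V \<in> span {X k}"
    by (simp add: span_scale span_base)
next
  fix V assume "V \<in> span {X k}"
  then show "V \<in> span {R i j, X k} \<inter> translation_vectors"
    using span_translations[of "{X k}"] X_in span_mono[of "{X k}" "{R i j, X k}"] by auto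
qed

lemma span_R_X_Int_rotation: "span {R i j, X k} \<inter> rotation_vectors = span {R i j}"
proof (intro subset_antisym subsetI)
  fix V assume V: "V \<in> span {R i j, X k} \<inter> rotation_vectors"
  then obtain s t where st: "V = s *\<^sub>R R i j + t *\<^sub>R X k"
    using span_pair[THEN iffD1] by blast
  have "V - s *\<^sub>R R i j \<in> rotation_vectors"
    using V[THEN IntD2] R_in[of i j] unfolding rotation_vectors_def by (intro span_diff span_scale)
  moreover have "V - s *\<^sub>R R i j \<in> translation_vectors"
    using X_in[of k] unfolding translation_vectors_def by (simp add: st span_scale)
  ultimately have "V = s *\<^sub>R R i j"
    using translation_rotation_0 by fastforce
  then show "V \<in> span {R i j}"
    by (simp add: span_scale span_base)
next
  fix V assume "V \<in> span {R i j}"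
  then show "V \<in> span {R i j, X k} \<inter> rotation_vectors"
    using span_rotations[of "{R i j}"] R_in span_mono[of "{R i j}" "{R i j, X k}"] by auto
qed

lemma Sym_elliptic_cylindrical1: "elliptic_cylindrical1_CKT k2 K \<Longrightarrow> Sym K = span {R 1 2}"
  unfolding elliptic_cylindrical1_CKT_def elliptic_cylindrical1_form_def
  using Sym_elliptic_cylindrical by blast

lemma Sym_elliptic_cylindrical2: "elliptic_cylindrical2_CKT k2 K \<Longrightarrow> Sym K = span {R 1 2}"
  unfolding elliptic_cylindrical2_CKT_def elliptic_cylindrical2_form_def
  using Sym_elliptic_cylindrical by blast

lemma canonical_counts:
  assumes "canonical w K"
  shows "(n_translations K, n_rotations K) = generator_counts w"
proof (cases w)
  case Cylindrical
  then have "Sym K = span {R 1 2, R 3 4}" using assms by (simp add: Sym_cylindrical)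
  from counts_of_rotations[OF this] show ?thesis
    using Cylindrical by (simp add: R_in dim_span_R12_R34 del: real_vector.dim_span)
next
  case Spherical
  then have "Sym K = span {R 1 2, X 4}" using assms by (simp add: Sym_spherical)
  then show ?thesis
    using Spherical
    by (simp only: n_translations_def n_rotations_def span_R_X_Int_translation span_R_X_Int_rotation)
      (simp add: dim_span_singleton X_nonzero R_nonzero del: real_vector.dim_span)
next
  case Spheroelliptic
  then have "Sym K = span {X 4}" using assms by (simp add: Sym_spheroelliptic)
  from counts_of_translations[OF this] show ?thesis
    using Spheroelliptic by (simp add: X_in dim_span_singleton X_nonzero del: real_vector.dim_span)
next
  case Elliptic_Cylindrical
  then have "Sym K = span {R 1 2}"
    using assms Sym_elliptic_cylindrical1 Sym_elliptic_cylindrical2 by auto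
  from counts_of_rotations[OF this] show ?thesis
    using Elliptic_Cylindrical by (simp add: R_in dim_span_singleton R_nonzero del: real_vector.dim_span)
next
  case Ellipsoidal
  then have "Sym K = span {}" using assms by (simp add: Sym_ellipsoidal)
  from counts_of_rotations[OF this] show ?thesis
    using Ellipsoidal by (simp add: dim_zero)
qed

section \<open>Recovering the category of an orbit from the counts\<close>

lemma canonical_CKT: "canonical w K \<Longrightarrow> CKT K"
  by (cases w) (auto simp: cylindrical_CKT_def spherical_CKT_def spheroelliptic_CKT_def
      elliptic_cylindrical1_CKT_def elliptic_cylindrical2_CKT_def ellipsoidal_CKT_def)

lemma in_category_counts:
  assumes "in_category w K"
  shows "(n_translations K, n_rotations K) = generator_counts w"
proof -
  obtain K' where K': "canonical w K'" "equivalent K' K"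
    using assms unfolding in_category_def by blast
  then show ?thesis
    using canonical_counts[OF K'(1)] equivalent_counts[OF K'(2) canonical_CKT[OF K'(1)]] by simp
qed

text \<open>Taken with the same tensor twice, this also shows that the categories are
  disjoint.\<close>

lemma in_category_unique:
  assumes "in_category w K" "in_category w' K'"
    and "n_translations K = n_translations K'" "n_rotations K = n_rotations K'"
  shows "w = w'"
  using in_category_counts[OF assms(1)] in_category_counts[OF assms(2)] assms(3,4)
  by (simp flip: generator_counts_inj)

lemma in_category_equivalent: "in_category w K \<Longrightarrow> equivalent K L \<Longrightarrow> in_category w L"
  unfolding in_category_def using equivalent_trans by blast

lemma in_categoryI:
  assumes "canonical w K'" "equivalent K' K"
  shows "\<exists>w. in_category w K"
  using assms unfolding in_category_def by blast

text \<open>If the orbit of \<open>K\<close> contained no canonical CKT, every exclusion clause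
  would hold for \<open>K\<close>, so \<open>K\<close> would itself be canonical. Degenerate
  parameters thus need no case analysis.\<close>

lemma form_in_category:
  assumes K: "CKT K"
    and form: "spherical_form K \<or> cylindrical_form K \<or> spheroelliptic_form K \<or>
      (\<exists>k2. elliptic_cylindrical1_form k2 K \<or> elliptic_cylindrical2_form k2 K) \<or> ellipsoidal_form K"
  shows "\<exists>w. in_category w K"
proof (cases "\<exists>w K'. canonical w K' \<and> equivalent K' K")
  case True
  then show ?thesis using in_categoryI by blast
next
  case False
  then have no: "\<not> canonical w K'" if "equivalent K' K" for w K' using that by blast
  note no' = no[of _ Spherical, simplified] no[of _ Cylindrical, simplified]
    no[of _ Spheroelliptic, simplified] no[of _ Elliptic_Cylindrical, simplified]
  have "spherical_CKT K \<or> cylindrical_CKT K \<or> spheroelliptic_CKT K \<or>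
      (\<exists>k2. elliptic_cylindrical1_CKT k2 K \<or> elliptic_cylindrical2_CKT k2 K) \<or> ellipsoidal_CKT K"
    using K form no'
    unfolding spherical_CKT_def[of K] cylindrical_CKT_def[of K] spheroelliptic_CKT_def[of K]
      elliptic_cylindrical1_CKT_def[of _ K] elliptic_cylindrical2_CKT_def[of _ K] ellipsoidal_CKT_def[of K]
    by blast
  then have "\<exists>w. canonical w K" using canonical.simps by blast
  then show ?thesis using no equivalent_refl by blast
qed

theorem mainTheorem2:
  shows
    "(\<forall>K. cylindrical_CKT K \<longrightarrow> Sym K = span {R 1 2, R 3 4}) \<and>
     (\<forall>K. spherical_CKT K \<longrightarrow> Sym K = span {R 1 2, X 4}) \<and>
     (\<forall>K. spheroelliptic_CKT K \<longrightarrow> Sym K = span {X 4}) \<and>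
     (\<forall>K k2. elliptic_cylindrical1_CKT k2 K \<longrightarrow> Sym K = span {R 1 2}) \<and>
     (\<forall>K k2. elliptic_cylindrical2_CKT k2 K \<longrightarrow> Sym K = span {R 1 2}) \<and>
     (\<forall>K. ellipsoidal_CKT K \<longrightarrow> Sym K = {0}) \<and>
     (\<forall>g V W. rotation_matrix g \<and> V \<in> translation_vectors \<and> V \<noteq> 0 \<and> W \<in> rotation_vectors \<and> W \<noteq> 0 \<longrightarrow>
        push_vec g V \<noteq> W \<and> push_vec g W \<noteq> V) \<and>
     (\<forall>K K'. CKT K \<and> CKT K' \<and> equivalent K K' \<longrightarrow>
        n_translations K = n_translations K' \<and> n_rotations K = n_rotations K') \<and>
     (\<forall>K K' w w'. in_category w K \<and> in_category w' K' \<and>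
        n_translations K = n_translations K' \<and> n_rotations K = n_rotations K' \<longrightarrow> w = w') \<and>
     (olevsky_classification \<longrightarrow>
        (\<forall>K K'. CKT K \<and> CKT K' \<and>
           n_translations K = n_translations K' \<and> n_rotations K = n_rotations K' \<longrightarrow>
           (\<forall>w. in_category w K \<longleftrightarrow> in_category w K')))"
proof (intro conjI allI impI; (elim conjE)?)
  show "Sym K = span {R 1 2, R 3 4}" if "cylindrical_CKT K" for K
    using that by (rule Sym_cylindrical)
  show "Sym K = span {R 1 2, X 4}" if "spherical_CKT K" for K
    using that by (rule Sym_spherical)
  show "Sym K = span {X 4}" if "spheroelliptic_CKT K" for K
    using that by (rule Sym_spheroelliptic)
  show "Sym K = span {R 1 2}" if "elliptic_cylindrical1_CKT k2 K" for K k2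
    using that by (rule Sym_elliptic_cylindrical1)
  show "Sym K = span {R 1 2}" if "elliptic_cylindrical2_CKT k2 K" for K k2
    using that by (rule Sym_elliptic_cylindrical2)
  show "Sym K = {0}" if "ellipsoidal_CKT K" for K
    using that by (rule Sym_ellipsoidal)
  \<comment> \<open>Push-forward preserves each type, and only 0 is of both types; the inverse
    push-forward shows that nonzero fields stay nonzero.\<close>
  show "push_vec g V \<noteq> W" "push_vec g W \<noteq> V"
    if "rotation_matrix g" "V \<in> translation_vectors" "V \<noteq> 0" "W \<in> rotation_vectors" "W \<noteq> 0" for g V W
    using that push_vec_translation[of g V] push_vec_rotation[of g W] push_vec_inverse(1)[of g]
      translation_rotation_0 rotation_matrix_orthogonal[of g] linear_0[OF linear_push_vec] by metis+
  show "n_translations K = n_translations K'" "n_rotations K = n_rotations K'"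
    if "CKT K" "CKT K'" "equivalent K K'" for K K'
    using that equivalent_counts by blast+
  show "w = w'"
    if "in_category w K" "in_category w' K'"
      "n_translations K = n_translations K'" "n_rotations K = n_rotations K'" for K K' w w'
    using that by (rule in_category_unique)
  show "in_category w K = in_category w K'"
    if "olevsky_classification" and K: "CKT K" "CKT K'"
      and n: "n_translations K = n_translations K'" "n_rotations K = n_rotations K'" for K K' w
  proof -
    \<comment> \<open>The classification enters only to give every CKT some category; equal counts
      then identify the two categories.\<close>
    have "\<exists>w. in_category w L" if L: "CKT L" for L
    proof -
      obtain L' where L': "equivalent L' L" and form: "spherical_form L' \<or> cylindrical_form L' \<or>
          spheroelliptic_form L' \<or> (\<exists>k2. elliptic_cylindrical1_form k2 L' \<or> elliptic_cylindrical2_form k2 L') \<or>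
          ellipsoidal_form L'"
        using \<open>olevsky_classification\<close> L unfolding olevsky_classification_def by blast
      have "CKT L'" using equivalent_CKT[OF equivalent_sym[OF L'] L] .
      from form_in_category[OF this form] show ?thesis
        using in_category_equivalent L' by blast
    qed
    with K obtain v v' where "in_category v K" "in_category v' K'" by blast
    then show ?thesis using n in_category_unique by metis
  qed
qed

end
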